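(* Let $\alpha\approx 0.278$ be the real solution of the equation $\alpha e^{1+\alpha}=1$. For every real $0\le\eta<\alpha/4$ there exists a constant $\gamma=\gamma(\eta)>0$ such that for every positive integer $n$ and every real $0<\epsilon<1$ there exists a polynomial $p=p_{n,\eta,\epsilon}$ in the entries of an $n\times n$ matrix $A=(a_{ij})$ such that $\deg p\le\gamma(\ln n-\ln\epsilon)$ and $$\left|\ln\operatorname{per}A-p(A)\right|\le\epsilon$$ for all $n\times n$ complex matrices $A=(a_{ij})$ satisfying $$\sum_{j=1}^n|1-a_{ij}|\le\eta n\quad\text{for }i=1,\dots,n\qquad\text{and}\qquad\sum_{i=1}^n|1-a_{ij}|\le\eta n\quad\text{for }j=1,\dots,n.$$
   Context: The permanent of an $n\times n$ matrix $A=(a_{ij})$ is $\operatorname{per}A=\sum_{\sigma\in S_n}\prod_{i=1}^n a_{i\sigma(i)}$, where $S_n$ is the symmetric group of permutations of $\{1,\dots,n\}$. Branch of the logarithm: let $D$ be the convex set of all $n\times n$ complex matrices $Z=(z_{ij})$ with $\sum_{j}|1-z_{ij}|\le\alpha n/4$ for all $i$ and $\sum_i|1-z_{ij}|\le\alpha n/4$ for all $j$. The permanent has no zeros on $D$, and $\ln\operatorname{per}$ denotes the continuous branch on $D$ (a continuous function $L$ with $e^{L(Z)}=\operatorname{per}Z$) which is real at real matrices; in particular its value at the all-ones matrix is the real number $\ln n!$. *)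

theory Defs
  imports "HOL-Analysis.Analysis" "HOL-Combinatorics.Permutations" "HOL-Library.Poly_Mapping"
begin

text \<open>
  An \<open>n \<times> n\<close> matrix is a function \<open>nat \<Rightarrow> nat \<Rightarrow> complex\<close> of which only the entries with both
  indices in \<open>{1..n}\<close> matter.  Sets of matrices carry the product topology of the function type.
\<close>

definition permanent :: "nat \<Rightarrow> (nat \<Rightarrow> nat \<Rightarrow> complex) \<Rightarrow> complex" where
  "permanent n A = (\<Sum>\<sigma> | \<sigma> permutes {1..n}. \<Prod>i = 1..n. A i (\<sigma> i))"

definition near_ones :: "nat \<Rightarrow> real \<Rightarrow> (nat \<Rightarrow> nat \<Rightarrow> complex) set" where
  "near_ones n r = {Z. (\<forall>i\<in>{1..n}. (\<Sum>j = 1..n. cmod (1 - Z i j)) \<le> r * real n) \<and>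
                       (\<forall>j\<in>{1..n}. (\<Sum>i = 1..n. cmod (1 - Z i j)) \<le> r * real n)}"

definition alpha :: real where
  "alpha = (THE x. x * exp (1 + x) = 1)"

lemma alpha_ex1: "\<exists>!x::real. x * exp (1 + x) = 1"
proof -
  have less: "x * exp (1 + x) < y * exp (1 + y)" if "0 < x" "x < y" for x y :: real
    using that by (intro mult_strict_mono) auto
  have pos: "0 < x" if "x * exp (1 + x) = 1" for x :: real
    using that by (metis exp_gt_zero zero_less_mult_pos2 zero_less_one)
  have "\<exists>x::real. 0 \<le> x \<and> x \<le> 1 \<and> x * exp (1 + x) = 1"
  proof (rule IVT')
    show "(1::real) \<le> 1 * exp (1 + 1)" by simp
    show "continuous_on {0..1} (\<lambda>x::real. x * exp (1 + x))" by (intro continuous_intros)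
  qed auto
  moreover have "x = y" if "x * exp (1 + x) = 1" "y * exp (1 + y) = 1" for x y :: real
    using less[of x y] less[of y x] pos[of x] pos[of y] that by (cases x y rule: linorder_cases) auto
  ultimately show ?thesis by blast
qed

lemma alpha_eq: "alpha * exp (1 + alpha) = 1"
  unfolding alpha_def by (rule theI'[OF alpha_ex1])

definition is_ln_per_branch :: "nat \<Rightarrow> ((nat \<Rightarrow> nat \<Rightarrow> complex) \<Rightarrow> complex) \<Rightarrow> bool" where
  "is_ln_per_branch n L \<longleftrightarrow>
     continuous_on (near_ones n (alpha / 4)) L \<and>
     (\<forall>Z\<in>near_ones n (alpha / 4). exp (L Z) = permanent n Z) \<and>
     (\<forall>Z\<in>near_ones n (alpha / 4). (\<forall>i\<in>{1..n}. \<forall>j\<in>{1..n}. Z i j \<in> \<real>) \<longrightarrow> L Z \<in> \<real>)"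

text \<open>
  Two branches agree on \<open>near_ones n (alpha / 4)\<close>: the set is convex, both branches have the value
  \<open>ln (fact n)\<close> at the all-ones matrix, and they differ by integer multiples of \<open>2 * pi * \<i>\<close>.  Hence
  the choice made here only affects values outside that set.
\<close>

definition ln_per :: "nat \<Rightarrow> (nat \<Rightarrow> nat \<Rightarrow> complex) \<Rightarrow> complex" where
  "ln_per n = (SOME L. is_ln_per_branch n L)"

text \<open>
  Multivariate polynomials with variables \<open>'x\<close>: finitely supported maps from monomials
  (finitely supported exponent functions) to coefficients.
\<close>

type_synonym ('x, 'c) mpoly = "('x \<Rightarrow>\<^sub>0 nat) \<Rightarrow>\<^sub>0 'c"

definition mpoly_vars :: "('x, 'c::zero) mpoly \<Rightarrow> 'x set" where
  "mpoly_vars p = (\<Union>m\<in>Poly_Mapping.keys p. Poly_Mapping.keys m)"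

text \<open>The total degree; the zero polynomial gets degree \<open>0\<close>.\<close>

definition mpoly_degree :: "('x, 'c::zero) mpoly \<Rightarrow> nat" where
  "mpoly_degree p = Max (insert 0
     ((\<lambda>m. \<Sum>x\<in>Poly_Mapping.keys m. Poly_Mapping.lookup m x) ` Poly_Mapping.keys p))"

definition mpoly_eval :: "('x \<Rightarrow> 'c) \<Rightarrow> ('x, 'c::comm_semiring_1) mpoly \<Rightarrow> 'c" where
  "mpoly_eval a p = (\<Sum>m\<in>Poly_Mapping.keys p. Poly_Mapping.lookup p m *
     (\<Prod>x\<in>Poly_Mapping.keys m. a x ^ Poly_Mapping.lookup m x))"

end

theory Submission
  imports Defs
    "HOL-Computational_Algebra.Fundamental_Theorem_Algebra"
    "HOL-Computational_Algebra.Polynomial_FPS"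
begin

text \<open>
  The approximating polynomial is a Taylor polynomial of \<open>ln per\<close> at the all-ones matrix \<open>J\<close>.  For
  fixed \<open>A\<close> the function \<open>g z = per (J + z * (A - J))\<close> is a polynomial of degree at most \<open>n\<close> with
  \<open>g 0 = fact n\<close>.  If the permanent has no zeros on \<open>near_ones n s\<close> and \<open>A\<close> lies in
  \<open>near_ones n r\<close> with \<open>r < s\<close>, then \<open>g z = fact n * (\<Prod>l<n. 1 + \<rho> l * z)\<close> with all
  \<open>norm (\<rho> l) \<le> r / s\<close> (\<open>line_poly_factors\<close>).  The Taylor series of \<open>ln g\<close> at \<open>0\<close> therefore
  converges geometrically at \<open>1\<close>, and cutting it after \<open>m\<close> terms costs at most
  \<open>n * (r / s) ^ (m + 1) / (1 - r / s)\<close> (\<open>ln_per_partial_error\<close>).  With \<open>r = \<eta>\<close> and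
  \<open>s = alpha / 4\<close> a degree \<open>m\<close> of order \<open>ln n - ln \<epsilon>\<close> suffices.  The \<open>m\<close>-th partial sum is a
  polynomial of degree at most \<open>m\<close> in the entries, because the coefficients of \<open>g' / g\<close> satisfy
  a recursion whose only division is by \<open>fact n\<close> (\<open>log_deriv_coeff_rec\<close>).

  The heart of the matter is the absence of zeros on \<open>near_ones n (alpha / 4)\<close>
  (\<open>permanent_nonzero\<close>).  With \<open>W = A - J\<close> and \<open>e k\<close> the sum of the products of entries of \<open>W\<close> over
  all matchings with \<open>k\<close> edges, the permanent is \<open>(\<Sum>k\<le>n. fact (n - k) * e k)\<close>.  The same sum
  without the factorials is the matching polynomial of \<open>W\<close>; it has no zeros as long as the absolute
  row and column sums are at most \<open>1 / 4\<close> (\<open>matching_sum_nonzero\<close>).  The factorials are put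
  back by a composition theorem (\<open>szegoe_composition\<close>): composing two polynomials of
  degree at most \<open>n\<close> in the sense of Szego preserves the absence of zeros in the unit disc, and the
  factorials arise from the truncated exponential series \<open>(\<Sum>k\<le>n. z ^ k / fact k)\<close>.  That series has
  no zeros for \<open>norm z \<le> alpha * n\<close>, which is where the equation defining \<open>alpha\<close> enters
  (\<open>alpha_bound\<close>).

  The value \<open>ln_per n A\<close> is tied to the series by uniqueness of the branch.  The series itself is
  a branch on \<open>near_ones n (alpha / 4)\<close>, closed boundary included, because for each \<open>n\<close> the
  zero-free region extends slightly further (\<open>is_ln_per_branch_series\<close>).
\<close>

section \<open>Polynomials without zeros in the unit disc\<close>

text \<open>
  Factoring from the constant term lets the degree be any bound \<open>n\<close>: zeros missing from the
  degree sit at infinity and show up as parameters \<open>r l = 0\<close>.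
\<close>
lemma poly_eq_prod_one_plus:
  fixes p :: "complex poly"
  assumes "degree p \<le> n" "coeff p 0 \<noteq> 0"
  shows "\<exists>r. p = smult (coeff p 0) (\<Prod>l<n. [:1, r l:])"
  using assms
proof (induction n arbitrary: p)
  case 0
  then have "p = [:coeff p 0:]"
    by (metis degree_eq_zeroE coeff_pCons_0 le_zero_eq)
  then show ?case by (auto simp: one_pCons)
next
  case (Suc n)
  show ?case
  proof (cases "degree p \<le> n")
    case True
    then obtain r where r: "p = smult (coeff p 0) (\<Prod>l<n. [:1, r l:])"
      using Suc by blast
    have "(\<Prod>l<Suc n. [:1, (r(n := 0)) l:]) = (\<Prod>l<n. [:1, r l:])"
      by (simp add: one_pCons [symmetric])
    with r show ?thesis by metis
  next
    case False
    then have deg: "degree p = Suc n" using Suc.prems by simp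
    then have "\<not> constant (poly p)" by (simp add: constant_degree)
    then obtain z where z: "poly p z = 0" using fundamental_theorem_of_algebra by blast
    then obtain q where q: "p = [:- z, 1:] * q" by (auto simp: poly_eq_0_iff_dvd)
    have p0: "coeff p 0 = - z * coeff q 0" by (simp add: q)
    with Suc.prems have nz: "z \<noteq> 0" "coeff q 0 \<noteq> 0" by auto
    then have "degree p = Suc (degree q)" unfolding q by (subst degree_mult_eq) auto
    then have "degree q \<le> n" using deg by simp
    then obtain r where r: "q = smult (coeff q 0) (\<Prod>l<n. [:1, r l:])"
      using Suc.IH nz by blast
    have "(\<Prod>l<Suc n. [:1, (r(n := - 1 / z)) l:]) = (\<Prod>l<n. [:1, r l:]) * [:1, - 1 / z:]"
      by simp
    moreover have "[:- z, 1:] = smult (- z) [:1, - 1 / z:]" using nz by simp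
    ultimately have "smult (coeff p 0) (\<Prod>l<Suc n. [:1, (r(n := - 1 / z)) l:])
        = [:- z, 1:] * smult (coeff q 0) (\<Prod>l<n. [:1, r l:])"
      by (metis (no_types, lifting) p0 mult.commute mult_smult_left mult_smult_right smult_smult)
    with r q show ?thesis by metis
  qed
qed

lemma one_plus_factor_zero:
  fixes r :: "nat \<Rightarrow> complex"
  assumes "p = smult c (\<Prod>l<n. [:1, r l:])" "l < n" "r l \<noteq> 0"
  shows "poly p (- 1 / r l) = 0"
proof -
  have "\<exists>i\<in>{..<n}. 1 - r i / r l = 0" using assms(2,3) by (intro bexI[of _ l]) auto
  then have "(\<Prod>i<n. 1 - r i / r l) = 0" by (intro prod_zero finite_lessThan)
  then show ?thesis unfolding assms(1) by (simp add: poly_prod)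
qed

text \<open>
  Points \<open>a\<close> with \<open>norm (1 - a) < \<rho> * norm a\<close> form a disc or a half-plane when \<open>\<rho> \<le> 1\<close>, so an
  average of such points is again one.  The inequality reads
  \<open>(1 - \<rho>\<^sup>2) * (norm a)\<^sup>2 - 2 * Re a + 1 < 0\<close>, and Cauchy-Schwarz controls the quadratic term.
\<close>
lemma apollonius_disc_average:
  fixes a :: "nat \<Rightarrow> complex"
  assumes n: "n > 0" and \<rho>: "0 \<le> \<rho>" "\<rho> \<le> 1"
    and a: "\<And>l. l < n \<Longrightarrow> norm (1 - a l) < \<rho> * norm (a l)"
  shows "norm (of_nat n - (\<Sum>l<n. a l)) < \<rho> * norm (\<Sum>l<n. a l)"
proof -
  define S where "S = (\<Sum>l<n. a l)"
  define T where "T = (\<Sum>l<n. (norm (a l))\<^sup>2)"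
  have sq: "(norm (of_real c - z))\<^sup>2 = c\<^sup>2 - 2 * c * Re z + (norm z)\<^sup>2" for c z
    by (simp add: cmod_power2) (simp add: algebra_simps power2_eq_square)
  have "(1 - \<rho>\<^sup>2) * (norm (a l))\<^sup>2 - 2 * Re (a l) + 1 < 0" if "l < n" for l
  proof -
    have "(norm (1 - a l))\<^sup>2 < (\<rho> * norm (a l))\<^sup>2"
      using a[OF that] by (intro power_strict_mono) auto
    then show ?thesis using sq[of 1 "a l"] by (simp add: power_mult_distrib algebra_simps)
  qed
  then have "(\<Sum>l<n. (1 - \<rho>\<^sup>2) * (norm (a l))\<^sup>2 - 2 * Re (a l) + 1) < (\<Sum>l<n. 0::real)"
    using n by (intro sum_strict_mono) auto
  then have neg: "(1 - \<rho>\<^sup>2) * T - 2 * Re S + real n < 0"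
    by (simp add: sum.distrib sum_subtractf sum_distrib_left [symmetric] T_def S_def)
  have "(norm S)\<^sup>2 \<le> (\<Sum>l<n. norm (a l))\<^sup>2"
    unfolding S_def by (intro power_mono norm_sum) auto
  also have "\<dots> \<le> real n * T"
    unfolding T_def using sum_squared_le_sum_of_squares[of "\<lambda>l. norm (a l)" "{..<n}"]
    by (simp add: mult.commute)
  finally have "(1 - \<rho>\<^sup>2) * (norm S)\<^sup>2 \<le> (1 - \<rho>\<^sup>2) * (real n * T)"
    using \<rho> by (intro mult_left_mono) (auto simp: power_le_one)
  moreover have "real n * ((1 - \<rho>\<^sup>2) * T - 2 * Re S + real n) < 0"
    using neg n by (simp add: mult_pos_neg)
  ultimately have "(norm (of_nat n - S))\<^sup>2 < (\<rho> * norm S)\<^sup>2"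
    using sq[of "real n" S] by (simp add: power_mult_distrib algebra_simps power2_eq_square)
  then have "norm (of_nat n - S) < \<rho> * norm S"
    by (rule power2_less_imp_less) (use \<rho> in simp)
  then show ?thesis by (simp add: S_def)
qed

definition polar_deriv :: "nat \<Rightarrow> complex \<Rightarrow> complex poly \<Rightarrow> complex poly" where
  "polar_deriv n \<zeta> f = smult (of_nat n) f + [:\<zeta>, - 1:] * pderiv f"

lemma coeff_polar_deriv:
  "coeff (polar_deriv n \<zeta> f) k
     = (of_nat n - of_nat k) * coeff f k + \<zeta> * (of_nat (Suc k) * coeff f (Suc k))"
  by (cases k) (simp_all add: polar_deriv_def coeff_pderiv algebra_simps)

text \<open>
  The terms of degree \<open>n\<close> cancel in \<open>n * f + (\<zeta> - z) * f'\<close>, so the degree bound drops with each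
  polar derivative.
\<close>
lemma degree_polar_deriv:
  assumes "degree f \<le> Suc n"
  shows "degree (polar_deriv (Suc n) \<zeta> f) \<le> n"
proof (rule degree_le, intro allI impI)
  fix k assume "n < k"
  then have "k = Suc n \<or> coeff f k = 0" "coeff f (Suc k) = 0"
    using assms by (auto intro!: coeff_eq_0)
  then show "coeff (polar_deriv (Suc n) \<zeta> f) k = 0"
    by (auto simp: coeff_polar_deriv)
qed

text \<open>
  Laguerre's theorem for the unit disc.  With \<open>f = c * (\<Prod>l. 1 + r l * z)\<close> and
  \<open>a l = 1 / (1 + r l * z)\<close>, a zero of the polar derivative at \<open>z \<noteq> 0\<close> says
  \<open>n * \<zeta> = (\<zeta> - z) * (\<Sum>l. a l)\<close>.  The \<open>a l\<close> lie in the convex set of \<open>apollonius_disc_average\<close>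
  with \<open>\<rho> = norm z\<close>, and their average is too close to \<open>1\<close> for this to happen with
  \<open>norm \<zeta> \<le> 1\<close>.  At \<open>z = 0\<close> the bounds \<open>norm (r l) < 1\<close> suffice.
\<close>
lemma polar_deriv_nonzero:
  assumes deg: "degree f \<le> n" and n: "n > 0" and \<zeta>: "norm \<zeta> \<le> 1" and z: "norm z \<le> 1"
    and nz: "\<And>z. norm z \<le> 1 \<Longrightarrow> poly f z \<noteq> 0"
  shows "poly (polar_deriv n \<zeta> f) z \<noteq> 0"
proof
  assume zero: "poly (polar_deriv n \<zeta> f) z = 0"
  define c where "c = coeff f 0"
  have c: "c \<noteq> 0" using nz[of 0] by (simp add: c_def poly_0_coeff_0)
  obtain r where r: "f = smult c (\<Prod>l<n. [:1, r l:])"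
    using poly_eq_prod_one_plus[OF deg] c unfolding c_def by blast
  have r1: "norm (r l) < 1" if "l < n" for l
  proof (rule ccontr)
    assume "\<not> norm (r l) < 1"
    then have "r l \<noteq> 0" "norm (- 1 / r l) \<le> 1" by (auto simp: norm_divide divide_simps)
    with one_plus_factor_zero[OF r that] nz show False by blast
  qed
  have lin: "1 + r l * w \<noteq> 0" if "norm w \<le> 1" "l < n" for l w
  proof
    assume "1 + r l * w = 0"
    then have "norm (r l * w) = 1" by (metis add_eq_0_iff norm_minus_cancel norm_one)
    moreover have "norm (r l) * norm w < 1"
      using mult_left_le[of "norm w" "norm (r l)"] r1[OF that(2)] that(1) by simp
    ultimately show False by (simp add: norm_mult)
  qed
  define a where "a l = 1 / (1 + r l * z)" for l
  define S where "S = (\<Sum>l<n. a l)"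
  have a: "a l \<noteq> 0" "1 - a l = r l * z * a l" if "l < n" for l
    using lin[OF z that] by (auto simp: a_def field_simps)
  have fz: "poly f z = c * (\<Prod>l<n. 1 + r l * z)"
    by (subst r) (simp add: poly_prod algebra_simps)
  have f'z: "poly (pderiv f) z = poly f z * (\<Sum>l<n. r l * a l)"
  proof -
    have "poly (pderiv f) z = c * (\<Sum>l<n. (\<Prod>m\<in>{..<n} - {l}. 1 + r m * z) * r l)"
      by (subst r)
        (simp add: pderiv_smult pderiv_prod poly_sum poly_prod pderiv_pCons algebra_simps)
    also have "(\<Sum>l<n. (\<Prod>m\<in>{..<n} - {l}. 1 + r m * z) * r l)
        = (\<Sum>l<n. (\<Prod>m<n. 1 + r m * z) * (r l * a l))"
    proof (intro sum.cong refl)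
      fix l assume l: "l \<in> {..<n}"
      then have "(\<Prod>m<n. 1 + r m * z) = (1 + r l * z) * (\<Prod>m\<in>{..<n} - {l}. 1 + r m * z)"
        by (subst prod.remove[of _ l]) auto
      then show "(\<Prod>m\<in>{..<n} - {l}. 1 + r m * z) * r l = (\<Prod>m<n. 1 + r m * z) * (r l * a l)"
        using lin[OF z, of l] l by (simp add: a_def)
    qed
    finally show ?thesis by (simp add: fz sum_distrib_left mult.assoc)
  qed
  have "poly (polar_deriv n \<zeta> f) z = poly f z * (of_nat n + (\<zeta> - z) * (\<Sum>l<n. r l * a l))"
    by (simp add: polar_deriv_def f'z algebra_simps)
  then have *: "of_nat n + (\<zeta> - z) * (\<Sum>l<n. r l * a l) = 0"
    using zero nz[OF z] by simp
  show False
  proof (cases "z = 0")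
    case True
    then have "of_nat n = - \<zeta> * (\<Sum>l<n. r l)" using * by (simp add: a_def add_eq_0_iff)
    then have "real n = norm \<zeta> * norm (\<Sum>l<n. r l)"
      by (metis norm_minus_cancel norm_mult norm_of_nat)
    also have "\<dots> \<le> 1 * norm (\<Sum>l<n. r l)" using \<zeta> by (intro mult_right_mono) auto
    also have "\<dots> \<le> (\<Sum>l<n. norm (r l))" by (simp add: norm_sum)
    also have "\<dots> < (\<Sum>l<n. 1)" using r1 n by (intro sum_strict_mono) auto
    finally show False by simp
  next
    case False
    have "norm (1 - a l) < norm z * norm (a l)" if "l < n" for l
      using a[OF that] r1[OF that] False by (simp add: norm_mult)
    then have av: "norm (of_nat n - S) < norm z * norm S"
      unfolding S_def using n z by (intro apollonius_disc_average) auto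
    have "z * (\<Sum>l<n. r l * a l) = (\<Sum>l<n. 1 - a l)"
      by (simp add: a(2) sum_distrib_left mult_ac)
    also have "\<dots> = of_nat n - S" by (simp add: S_def sum_subtractf)
    finally have "z * of_nat n + (\<zeta> - z) * (of_nat n - S) = 0"
      using * by (metis distrib_left mult.left_commute mult_zero_right)
    then have "z * S = \<zeta> * (S - of_nat n)" by algebra
    then have "norm z * norm S = norm \<zeta> * norm (S - of_nat n)" by (metis norm_mult)
    also have "\<dots> \<le> norm (S - of_nat n)" using \<zeta> by (simp add: mult_left_le_one_le)
    finally show False using av by (simp add: norm_minus_commute)
  qed
qed

text \<open>
  A composition theorem of Grace and Szego type.  Up to the factor \<open>fact n\<close> the sum is the
  symmetric multiaffine form of \<open>f\<close> evaluated at \<open>\<zeta> 0, \<dots>, \<zeta> (n - 1)\<close>, which is what \<open>n\<close>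
  successive polar derivatives at these points leave behind.
\<close>
lemma szegoe_composition:
  assumes "degree f \<le> n" "\<And>l. l < n \<Longrightarrow> norm (\<zeta> l) \<le> 1"
    and "\<And>z. norm z \<le> 1 \<Longrightarrow> poly f z \<noteq> 0"
  shows "(\<Sum>k\<le>n. fact k * fact (n - k) * coeff f k * coeff (\<Prod>l<n. [:1, \<zeta> l:]) k) \<noteq> (0::complex)"
  using assms
proof (induction n arbitrary: f)
  case 0
  from "0.prems"(3)[of 0] show ?case by (simp add: poly_0_coeff_0)
next
  case (Suc n)
  define h where "h = polar_deriv (Suc n) (\<zeta> n) f"
  define E where "E = coeff (\<Prod>l<n. [:1, \<zeta> l:])"
  have E_top: "E (Suc n) = 0"
  proof -
    have "degree (\<Prod>l<n. [:1, \<zeta> l:]) \<le> (\<Sum>l<n. degree [:1, \<zeta> l:])"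
      using degree_prod_sum_le[of "{..<n}" "\<lambda>l. [:1, \<zeta> l:]"] by (simp add: o_def)
    also have "\<dots> \<le> (\<Sum>l<n. 1)" by (intro sum_mono) auto
    finally show ?thesis unfolding E_def by (intro coeff_eq_0) simp
  qed
  have coeff_prod: "coeff (\<Prod>l<Suc n. [:1, \<zeta> l:]) k
      = E k + \<zeta> n * (case k of 0 \<Rightarrow> 0 | Suc j \<Rightarrow> E j)" for k
    by (cases k) (simp_all add: E_def mult.commute[of _ "[:1, \<zeta> n:]"])
  have "(\<Sum>k\<le>Suc n. fact k * fact (Suc n - k) * coeff f k * coeff (\<Prod>l<Suc n. [:1, \<zeta> l:]) k)
      = (\<Sum>k\<le>Suc n. fact k * fact (Suc n - k) * coeff f k * E k)
        + \<zeta> n * (\<Sum>k\<le>Suc n. fact k * fact (Suc n - k) * coeff f k *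
            (case k of 0 \<Rightarrow> 0 | Suc j \<Rightarrow> E j))"
    by (simp only: coeff_prod distrib_left sum.distrib sum_distrib_left mult_ac)
  also have "(\<Sum>k\<le>Suc n. fact k * fact (Suc n - k) * coeff f k * E k)
      = (\<Sum>k\<le>n. fact k * fact (Suc n - k) * coeff f k * E k)"
    by (simp add: E_top)
  also have "(\<Sum>k\<le>Suc n. fact k * fact (Suc n - k) * coeff f k * (case k of 0 \<Rightarrow> 0 | Suc j \<Rightarrow> E j))
      = (\<Sum>k\<le>n. fact (Suc k) * fact (n - k) * coeff f (Suc k) * E k)"
    by (subst sum.atMost_Suc_shift) simp
  also have "(\<Sum>k\<le>n. fact k * fact (Suc n - k) * coeff f k * E k)
        + \<zeta> n * (\<Sum>k\<le>n. fact (Suc k) * fact (n - k) * coeff f (Suc k) * E k)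
      = (\<Sum>k\<le>n. fact k * fact (n - k) * coeff h k * E k)"
  proof (subst sum_distrib_left, subst sum.distrib [symmetric], intro sum.cong refl)
    fix k assume "k \<in> {..n}"
    then have fact_diff: "fact (Suc n - k) = (of_nat (Suc n) - of_nat k) * (fact (n - k) :: complex)"
      by (simp add: Suc_diff_le of_nat_diff)
    then show "fact k * fact (Suc n - k) * coeff f k * E k
        + \<zeta> n * (fact (Suc k) * fact (n - k) * coeff f (Suc k) * E k)
        = fact k * fact (n - k) * coeff h k * E k"
      by (subst fact_diff) (simp add: h_def coeff_polar_deriv algebra_simps)
  qed
  also have "\<dots> \<noteq> 0"
    unfolding E_def
  proof (rule Suc.IH)
    show "degree h \<le> n" unfolding h_def using Suc.prems(1) by (rule degree_polar_deriv)
    show "poly h z \<noteq> 0" if "norm z \<le> 1" for z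
      unfolding h_def using Suc.prems that by (intro polar_deriv_nonzero) auto
  qed (use Suc.prems in auto)
  finally show ?case .
qed

section \<open>Truncated exponential series\<close>

text \<open>
  The derivative of \<open>exp (- z) * (\<Sum>k\<le>n. z ^ k / fact k)\<close> telescopes to
  \<open>- exp (- z) * z ^ n / fact n\<close>.  Integrating its norm along the segment from \<open>0\<close> to \<open>z\<close> bounds
  the distance of the product from its value \<open>1\<close> at \<open>0\<close>.
\<close>
lemma exp_partial_sum_nonzero:
  fixes z :: complex
  assumes "norm z ^ Suc n * exp (norm z) < fact (Suc n)"
  shows "(\<Sum>k\<le>n. z ^ k / fact k) \<noteq> 0"
proof
  assume zero: "(\<Sum>k\<le>n. z ^ k / fact k) = 0"
  define F where "F w = exp (- w) * (\<Sum>k\<le>n. w ^ k / fact k)" for w :: complex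
  have dsum: "((\<lambda>w. \<Sum>k\<le>n. w ^ k / fact k) has_field_derivative (\<Sum>k<n. w ^ k / fact k)) (at w)"
    for w :: complex
  proof -
    have "((\<lambda>w. \<Sum>k\<le>n. w ^ k / fact k) has_field_derivative
        (\<Sum>k\<le>n. of_nat k * w ^ (k - 1) / fact k)) (at w)"
      by (auto intro!: derivative_eq_intros)
    moreover have "(\<Sum>k\<le>n. of_nat k * w ^ (k - 1) / fact k) = (\<Sum>k<n. w ^ k / fact k)"
    proof (cases n)
      case (Suc m)
      show ?thesis unfolding Suc
        by (subst sum.atMost_Suc_shift)
          (simp add: lessThan_Suc_atMost divide_simps del: of_nat_Suc)
    qed simp
    ultimately show ?thesis by simp
  qed
  have dF: "(F has_field_derivative - exp (- w) * w ^ n / fact n) (at w)" for w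
  proof -
    have "(F has_field_derivative
        - exp (- w) * (\<Sum>k\<le>n. w ^ k / fact k) + exp (- w) * (\<Sum>k<n. w ^ k / fact k)) (at w)"
      unfolding F_def by (rule derivative_eq_intros dsum refl | simp)+
    then show ?thesis
      by (simp add: lessThan_Suc_atMost [symmetric] algebra_simps)
  qed
  define \<phi> where "\<phi> t = norm z ^ Suc n * exp (norm z) / fact (Suc n) * t ^ Suc n" for t :: real
  define F' where "F' t = - exp (- (of_real t * z)) * (of_real t * z) ^ n / fact n * z" for t :: real
  have path: "((\<lambda>t. F (of_real t * z)) has_vector_derivative F' t) (at t)" for t
  proof -
    have "((\<lambda>w. F (w * z)) has_field_derivative
        - exp (- (of_real t * z)) * (of_real t * z) ^ n / fact n * z) (at (of_real t))"
      by (rule DERIV_chain2[OF dF]) (auto intro!: derivative_eq_intros)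
    from has_vector_derivative_real_field[OF this] show ?thesis by (simp add: F'_def)
  qed
  have "norm (F (of_real 1 * z) - F (of_real 0 * z)) \<le> \<phi> 1 - \<phi> 0"
  proof (rule differentiable_bound_general[where a = 0 and b = "1::real"])
    show "continuous_on {0..1} (\<lambda>t. F (of_real t * z))"
      using path by (meson continuous_at_imp_continuous_on has_vector_derivative_continuous)
    show "continuous_on {0..1} \<phi>" unfolding \<phi>_def by (intro continuous_intros)
    show "((\<lambda>t. F (of_real t * z)) has_vector_derivative F' t) (at t)" for t by (rule path)
    show "(\<phi> has_vector_derivative norm z ^ Suc n * exp (norm z) / fact n * t ^ n) (at t)" for t
      unfolding \<phi>_def has_real_derivative_iff_has_vector_derivative [symmetric]
      by (rule derivative_eq_intros refl | simp add: divide_simps)+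
    show "norm (F' t) \<le> norm z ^ Suc n * exp (norm z) / fact n * t ^ n" if "0 < t" "t < 1" for t
    proof -
      have "norm (exp (- (of_real t * z))) \<le> exp (norm (- (of_real t * z)))" by (rule norm_exp)
      also have "\<dots> \<le> exp (norm z)" using that by (simp add: norm_mult mult_left_le_one_le)
      finally have "norm (exp (- (of_real t * z))) * (norm z ^ Suc n * t ^ n)
          \<le> exp (norm z) * (norm z ^ Suc n * t ^ n)"
        using that by (intro mult_right_mono) auto
      moreover have "norm (F' t) = norm (exp (- (of_real t * z))) * (norm z ^ Suc n * t ^ n) / fact n"
        using that by (simp add: F'_def norm_mult norm_divide norm_power power_mult_distrib)
      ultimately show ?thesis by (simp add: divide_right_mono mult_ac)
    qed
  qed simp
  moreover have "F z = 0" by (simp add: F_def zero)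
  moreover have "F 0 = 1" by (simp add: F_def sum.atMost_shift)
  ultimately have "1 \<le> norm z ^ Suc n * exp (norm z) / fact (Suc n)"
    by (simp add: \<phi>_def)
  moreover have "norm z ^ Suc n * exp (norm z) / fact (Suc n) < 1"
    by (subst divide_less_eq_1_pos) (use assms in auto)
  ultimately show False by linarith
qed

section \<open>The matching sum of a complete bipartite graph\<close>

text \<open>Injectivity of the projections says that no two edges share a row or a column.\<close>
definition matchings :: "'a set \<Rightarrow> 'b set \<Rightarrow> ('a \<times> 'b) set set" where
  "matchings I J = {M. M \<subseteq> I \<times> J \<and> inj_on fst M \<and> inj_on snd M}"

definition matching_sum :: "('a \<times> 'b \<Rightarrow> complex) \<Rightarrow> 'a set \<Rightarrow> 'b set \<Rightarrow> complex" where
  "matching_sum w I J = (\<Sum>M\<in>matchings I J. \<Prod>e\<in>M. w e)"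

lemma finite_matchings: "finite I \<Longrightarrow> finite J \<Longrightarrow> finite (matchings I J)"
  by (rule finite_subset[of _ "Pow (I \<times> J)"]) (auto simp: matchings_def)

lemma finite_matching: "M \<in> matchings I J \<Longrightarrow> finite I \<Longrightarrow> finite J \<Longrightarrow> finite M"
  by (auto simp: matchings_def intro: finite_subset)

lemma card_matching_le:
  assumes "M \<in> matchings I J" "finite I"
  shows "card M \<le> card I"
proof (rule card_inj_on_le)
  show "inj_on fst M" "fst ` M \<subseteq> I" using assms(1) by (auto simp: matchings_def)
qed fact

lemma matchings_empty_left: "matchings {} J = {{}}"
  by (auto simp: matchings_def)

lemma matching_sum_empty_left: "matching_sum w {} J = 1"
  by (simp add: matching_sum_def matchings_empty_left)

lemma matchings_insert_row:
  assumes "i \<notin> I"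
  shows "matchings (insert i I) J
      = matchings I J \<union> (\<Union>j\<in>J. insert (i, j) ` matchings I (J - {j}))"
proof (intro equalityI subsetI)
  fix M assume M: "M \<in> matchings (insert i I) J"
  show "M \<in> matchings I J \<union> (\<Union>j\<in>J. insert (i, j) ` matchings I (J - {j}))"
  proof (cases "\<exists>j. (i, j) \<in> M")
    case False
    then have "M \<in> matchings I J" using M by (auto simp: matchings_def)
    then show ?thesis by simp
  next
    case True
    then obtain j where j: "(i, j) \<in> M" by blast
    have inj: "inj_on fst M" "inj_on snd M" using M by (auto simp: matchings_def)
    have sub: "M \<subseteq> insert i I \<times> J" using M by (auto simp: matchings_def)
    have "e \<in> I \<times> (J - {j})" if e: "e \<in> M - {(i, j)}" for e
    proof -
      have "fst e \<noteq> fst (i, j)" "snd e \<noteq> snd (i, j)"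
        using inj_on_eq_iff[OF inj(1), of e "(i, j)"] inj_on_eq_iff[OF inj(2), of e "(i, j)"] e j
        by blast+
      moreover have "e \<in> insert i I \<times> J" using e sub by blast
      ultimately show ?thesis by (cases e) simp
    qed
    then have "M - {(i, j)} \<subseteq> I \<times> (J - {j})" by (rule subsetI)
    then have "M - {(i, j)} \<in> matchings I (J - {j})"
      using inj by (auto simp: matchings_def intro: inj_on_diff)
    moreover have "M = insert (i, j) (M - {(i, j)})" "j \<in> J"
      using j M by (auto simp: matchings_def)
    ultimately show ?thesis by blast
  qed
next
  fix M assume "M \<in> matchings I J \<union> (\<Union>j\<in>J. insert (i, j) ` matchings I (J - {j}))"
  then show "M \<in> matchings (insert i I) J"
    using assms by (auto simp: matchings_def inj_on_def)
qed

lemma matching_sum_insert_row: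
  assumes "finite I" "finite J" "i \<notin> I"
  shows "matching_sum w (insert i I) J
      = matching_sum w I J + (\<Sum>j\<in>J. w (i, j) * matching_sum w I (J - {j}))"
proof -
  have new: "(i, j) \<notin> M" if "M \<in> matchings I K" for j K M
    using that assms(3) by (auto simp: matchings_def)
  have inj: "inj_on (insert (i, j)) (matchings I (J - {j}))" for j
    by (intro inj_onI) (metis insert_ident new)
  have "(\<Sum>M\<in>(\<Union>j\<in>J. insert (i, j) ` matchings I (J - {j})). \<Prod>e\<in>M. w e)
      = (\<Sum>j\<in>J. \<Sum>M\<in>insert (i, j) ` matchings I (J - {j}). \<Prod>e\<in>M. w e)"
  proof (rule sum.UNION_disjoint)
    show "\<forall>j\<in>J. \<forall>k\<in>J. j \<noteq> k \<longrightarrow>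
        insert (i, j) ` matchings I (J - {j}) \<inter> insert (i, k) ` matchings I (J - {k}) = {}"
    proof (intro ballI impI equals0I)
      fix j k N assume "j \<noteq> k" and
        N: "N \<in> insert (i, j) ` matchings I (J - {j}) \<inter> insert (i, k) ` matchings I (J - {k})"
      from N obtain A where "N = insert (i, j) A" by auto
      moreover from N obtain B where "N = insert (i, k) B" "B \<in> matchings I (J - {k})" by auto
      ultimately show False using \<open>j \<noteq> k\<close> new[of B "J - {k}" j] by auto
    qed
  qed (use assms in \<open>auto simp: finite_matchings\<close>)
  also have "\<dots> = (\<Sum>j\<in>J. w (i, j) * matching_sum w I (J - {j}))"
  proof (intro sum.cong refl)
    fix j assume "j \<in> J"
    have "(\<Sum>M\<in>insert (i, j) ` matchings I (J - {j}). \<Prod>e\<in>M. w e)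
        = (\<Sum>M\<in>matchings I (J - {j}). \<Prod>e\<in>insert (i, j) M. w e)"
      by (simp add: sum.reindex[OF inj])
    also have "\<dots> = (\<Sum>M\<in>matchings I (J - {j}). w (i, j) * (\<Prod>e\<in>M. w e))"
      using assms(1,2) by (intro sum.cong refl prod.insert) (auto dest: new finite_matching)
    finally show "(\<Sum>M\<in>insert (i, j) ` matchings I (J - {j}). \<Prod>e\<in>M. w e)
        = w (i, j) * matching_sum w I (J - {j})"
      by (simp add: matching_sum_def sum_distrib_left)
  qed
  finally have *: "(\<Sum>M\<in>(\<Union>j\<in>J. insert (i, j) ` matchings I (J - {j})). \<Prod>e\<in>M. w e)
      = (\<Sum>j\<in>J. w (i, j) * matching_sum w I (J - {j}))" .
  have "matchings I J \<inter> (\<Union>j\<in>J. insert (i, j) ` matchings I (J - {j})) = {}"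
    by (auto dest: new)
  then have "matching_sum w (insert i I) J = matching_sum w I J
      + (\<Sum>M\<in>(\<Union>j\<in>J. insert (i, j) ` matchings I (J - {j})). \<Prod>e\<in>M. w e)"
    unfolding matching_sum_def matchings_insert_row[OF assms(3)]
    using assms by (intro sum.union_disjoint) (auto simp: finite_matchings)
  with * show ?thesis by simp
qed

lemma matching_sum_swap: "matching_sum (w \<circ> prod.swap) J I = matching_sum w I J"
proof -
  have sub: "image prod.swap ` matchings K L \<subseteq> matchings L K" for K :: "'x set" and L :: "'y set"
  proof (rule image_subsetI)
    fix M assume M: "M \<in> matchings K L"
    have "fst \<circ> prod.swap = (snd :: 'x \<times> 'y \<Rightarrow> 'y)" "snd \<circ> prod.swap = (fst :: 'x \<times> 'y \<Rightarrow> 'x)"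
      by auto
    then have "inj_on fst (prod.swap ` M)" "inj_on snd (prod.swap ` M)"
      using M by (auto simp: matchings_def intro!: inj_on_imageI)
    then show "prod.swap ` M \<in> matchings L K" using M by (auto simp: matchings_def)
  qed
  have "bij_betw (image prod.swap) (matchings J I) (matchings I J)"
    by (rule bij_betw_byWitness[where f' = "image prod.swap"]) (use sub in \<open>auto simp: image_image\<close>)
  then have "matching_sum w I J = (\<Sum>M\<in>matchings J I. \<Prod>e\<in>prod.swap ` M. w e)"
    unfolding matching_sum_def by (rule sum.reindex_bij_betw [symmetric])
  then show ?thesis
    by (simp add: matching_sum_def prod.reindex)
qed

text \<open>
  Adding a row changes the sum by at most \<open>1 / 4\<close> of the largest sum with one column removed.  If
  removing a column at most doubles the norm, the change is at most half of the old norm and at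
  least half of the old norm remains.  So removing the row again at most doubles the norm, and the
  bound \<open>2\<close> reproduces itself with rows and columns alternating.
\<close>
lemma matching_sum_ratio_step:
  assumes "finite I" "finite J" "i \<notin> I"
    and row: "(\<Sum>j\<in>J. norm (w (i, j))) \<le> 1 / 4"
    and ratio: "\<And>j. j \<in> J \<Longrightarrow> norm (matching_sum w I (J - {j})) \<le> 2 * norm (matching_sum w I J)"
  shows "norm (matching_sum w I J) \<le> 2 * norm (matching_sum w (insert i I) J)"
proof -
  define m where "m = norm (matching_sum w I J)"
  have "norm (\<Sum>j\<in>J. w (i, j) * matching_sum w I (J - {j}))
      \<le> (\<Sum>j\<in>J. norm (w (i, j)) * (2 * m))"
    using ratio by (intro sum_norm_le) (auto simp: norm_mult m_def intro!: mult_left_mono)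
  also have "\<dots> = (\<Sum>j\<in>J. norm (w (i, j))) * (2 * m)" by (simp add: sum_distrib_right)
  also have "\<dots> \<le> 1 / 4 * (2 * m)" using row by (intro mult_right_mono) (auto simp: m_def)
  finally have "norm (\<Sum>j\<in>J. w (i, j) * matching_sum w I (J - {j})) \<le> m / 2" by simp
  moreover have "matching_sum w I J = matching_sum w (insert i I) J
      - (\<Sum>j\<in>J. w (i, j) * matching_sum w I (J - {j}))"
    by (simp add: matching_sum_insert_row[OF assms(1-3)])
  then have "m \<le> norm (matching_sum w (insert i I) J)
      + norm (\<Sum>j\<in>J. w (i, j) * matching_sum w I (J - {j}))"
    unfolding m_def by (metis norm_triangle_ineq4)
  ultimately show ?thesis by (simp add: m_def)
qed

lemma matching_sum_ratio:
  fixes w :: "'a \<times> 'b \<Rightarrow> complex"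
  assumes "finite I" "finite J"
    and "\<And>i. i \<in> I \<Longrightarrow> (\<Sum>j\<in>J. norm (w (i, j))) \<le> 1 / 4"
    and "\<And>j. j \<in> J \<Longrightarrow> (\<Sum>i\<in>I. norm (w (i, j))) \<le> 1 / 4"
  shows "(\<forall>i\<in>I. norm (matching_sum w (I - {i}) J) \<le> 2 * norm (matching_sum w I J)) \<and>
         (\<forall>j\<in>J. norm (matching_sum w I (J - {j})) \<le> 2 * norm (matching_sum w I J))"
  using assms
proof (induction "card I + card J" arbitrary: I J rule: less_induct)
  case less
  have rows: "(\<Sum>j\<in>J'. norm (w (i, j))) \<le> 1 / 4" if "i \<in> I" "J' \<subseteq> J" for i J'
    using less.prems that sum_mono2[of J J' "\<lambda>j. norm (w (i, j))"] by force
  have cols: "(\<Sum>i\<in>I'. norm (w (i, j))) \<le> 1 / 4" if "j \<in> J" "I' \<subseteq> I" for j I'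
    using less.prems that sum_mono2[of I I' "\<lambda>i. norm (w (i, j))"] by force
  show ?case
  proof (intro conjI ballI)
    fix i assume i: "i \<in> I"
    then have small: "card (I - {i}) + card J < card I + card J"
      using card_Diff1_less[OF less.prems(1) i] by linarith
    have IH: "\<forall>j\<in>J. norm (matching_sum w (I - {i}) (J - {j})) \<le> 2 * norm (matching_sum w (I - {i}) J)"
      by (rule less.hyps[OF small finite_Diff[OF less.prems(1)] less.prems(2), THEN conjunct2])
        ((rule rows; blast), (rule cols; blast))
    have "norm (matching_sum w (I - {i}) J) \<le> 2 * norm (matching_sum w (insert i (I - {i})) J)"
    proof (rule matching_sum_ratio_step[OF finite_Diff[OF less.prems(1)] less.prems(2)])
      show "(\<Sum>j\<in>J. norm (w (i, j))) \<le> 1 / 4" using i by (rule less.prems(3))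
      show "norm (matching_sum w (I - {i}) (J - {j})) \<le> 2 * norm (matching_sum w (I - {i}) J)"
        if "j \<in> J" for j
        using IH that by blast
    qed simp
    with i show "norm (matching_sum w (I - {i}) J) \<le> 2 * norm (matching_sum w I J)"
      by (simp add: insert_absorb)
  next
    fix j assume j: "j \<in> J"
    then have small: "card I + card (J - {j}) < card I + card J"
      using card_Diff1_less[OF less.prems(2) j] by linarith
    have IH: "\<forall>i\<in>I. norm (matching_sum w (I - {i}) (J - {j})) \<le> 2 * norm (matching_sum w I (J - {j}))"
      by (rule less.hyps[OF small less.prems(1) finite_Diff[OF less.prems(2)], THEN conjunct1])
        ((rule rows; blast), (rule cols; blast))
    have "norm (matching_sum (w \<circ> prod.swap) (J - {j}) I)
        \<le> 2 * norm (matching_sum (w \<circ> prod.swap) (insert j (J - {j})) I)"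
    proof (rule matching_sum_ratio_step[OF finite_Diff[OF less.prems(2)] less.prems(1)])
      show "(\<Sum>i\<in>I. norm ((w \<circ> prod.swap) (j, i))) \<le> 1 / 4"
        using less.prems(4)[OF j] by simp
      show "norm (matching_sum (w \<circ> prod.swap) (J - {j}) (I - {i}))
          \<le> 2 * norm (matching_sum (w \<circ> prod.swap) (J - {j}) I)" if "i \<in> I" for i
        unfolding matching_sum_swap
        using IH that by blast
    qed simp
    with j show "norm (matching_sum w I (J - {j})) \<le> 2 * norm (matching_sum w I J)"
      by (simp add: insert_absorb matching_sum_swap)
  qed
qed

lemma matching_sum_nonzero:
  assumes "finite I" "finite J"
    and "\<And>i. i \<in> I \<Longrightarrow> (\<Sum>j\<in>J. norm (w (i, j))) \<le> 1 / 4"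
    and "\<And>j. j \<in> J \<Longrightarrow> (\<Sum>i\<in>I. norm (w (i, j))) \<le> 1 / 4"
  shows "matching_sum w I J \<noteq> 0"
  using assms
proof (induction I rule: finite_induct)
  case empty
  show ?case by (simp add: matching_sum_empty_left)
next
  case (insert i I)
  have cols: "(\<Sum>i\<in>I. norm (w (i, j))) \<le> 1 / 4" if "j \<in> J" for j
  proof -
    have "(\<Sum>i\<in>I. norm (w (i, j))) \<le> (\<Sum>i\<in>insert i I. norm (w (i, j)))"
      using insert.hyps(1) by (intro sum_mono2) auto
    then show ?thesis using insert.prems(3)[OF that] by (rule order_trans)
  qed
  then have "matching_sum w I J \<noteq> 0" using insert by blast
  moreover have "norm (matching_sum w I J) \<le> 2 * norm (matching_sum w (insert i I) J)"
    using matching_sum_ratio[of "insert i I" J w] insert by simp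
  ultimately show ?case by auto
qed

section \<open>The permanent as a weighted matching sum\<close>

text \<open>
  Composition with one fixed extension of \<open>f\<close> matches these permutations with those that fix \<open>K\<close>
  pointwise.
\<close>
lemma card_permutations_extending:
  assumes fin: "finite S" and K: "K \<subseteq> S" and f: "inj_on f K" "f ` K \<subseteq> S"
  shows "card {\<sigma>. \<sigma> permutes S \<and> (\<forall>i\<in>K. \<sigma> i = f i)} = fact (card S - card K)"
proof -
  have "card (S - K) = card (S - f ` K)"
    using fin K f by (simp add: card_Diff_subset finite_subset card_image)
  then obtain g where g: "bij_betw g (S - K) (S - f ` K)"
    using fin by (metis finite_Diff finite_same_card_bij)
  define \<tau> where "\<tau> x = (if x \<in> K then f x else if x \<in> S then g x else x)" for x
  have "bij_betw \<tau> K (f ` K)"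
    using f(1) by (intro bij_betwI') (auto simp: \<tau>_def inj_on_eq_iff)
  moreover have "bij_betw \<tau> (S - K) (S - f ` K)"
    using g by (rule bij_betw_cong[THEN iffD1, rotated]) (auto simp: \<tau>_def)
  ultimately have "bij_betw \<tau> (K \<union> (S - K)) (f ` K \<union> (S - f ` K))"
    by (rule bij_betw_combine) auto
  then have "bij_betw \<tau> S S" using K f(2) by (simp add: Un_absorb1)
  then have \<tau>: "\<tau> permutes S" using K by (intro bij_imp_permutes) (auto simp: \<tau>_def)
  have "bij_betw (\<lambda>\<pi>. \<tau> \<circ> \<pi>) {\<pi>. \<pi> permutes (S - K)} {\<sigma>. \<sigma> permutes S \<and> (\<forall>i\<in>K. \<sigma> i = f i)}"
  proof (rule bij_betw_byWitness[where f' = "\<lambda>\<sigma>. inv \<tau> \<circ> \<sigma>"])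
    show "\<forall>\<pi>\<in>{\<pi>. \<pi> permutes (S - K)}. inv \<tau> \<circ> (\<tau> \<circ> \<pi>) = \<pi>"
      using permutes_inverses[OF \<tau>] by (auto simp: fun_eq_iff)
    show "\<forall>\<sigma>\<in>{\<sigma>. \<sigma> permutes S \<and> (\<forall>i\<in>K. \<sigma> i = f i)}. \<tau> \<circ> (inv \<tau> \<circ> \<sigma>) = \<sigma>"
      using permutes_inverses[OF \<tau>] by (auto simp: fun_eq_iff)
    show "(\<lambda>\<pi>. \<tau> \<circ> \<pi>) ` {\<pi>. \<pi> permutes (S - K)} \<subseteq> {\<sigma>. \<sigma> permutes S \<and> (\<forall>i\<in>K. \<sigma> i = f i)}"
    proof (clarsimp, intro conjI ballI)
      fix \<pi> assume \<pi>: "\<pi> permutes (S - K)"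
      then have "\<pi> permutes S" by (rule permutes_subset) auto
      then show "(\<tau> \<circ> \<pi>) permutes S" using \<tau> by (rule permutes_compose)
      fix i assume "i \<in> K"
      then have "\<pi> i = i" using permutes_not_in[OF \<pi>] by simp
      then show "\<tau> (\<pi> i) = f i" using \<open>i \<in> K\<close> by (simp add: \<tau>_def)
    qed
    show "(\<lambda>\<sigma>. inv \<tau> \<circ> \<sigma>) ` {\<sigma>. \<sigma> permutes S \<and> (\<forall>i\<in>K. \<sigma> i = f i)} \<subseteq> {\<pi>. \<pi> permutes (S - K)}"
    proof clarsimp
      fix \<sigma> assume \<sigma>: "\<sigma> permutes S" "\<forall>i\<in>K. \<sigma> i = f i"
      have S: "(inv \<tau> \<circ> \<sigma>) permutes S"
        using \<sigma>(1) permutes_inv[OF \<tau>] by (rule permutes_compose)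
      have "(inv \<tau> \<circ> \<sigma>) x = x" if "x \<in> K" for x
        using that \<sigma>(2) permutes_inverses[OF \<tau>] by (simp add: \<tau>_def permutes_inv_eq[OF \<tau>])
      then show "(inv \<tau> \<circ> \<sigma>) permutes (S - K)"
        using S by (intro permutes_superset[OF S]) auto
    qed
  qed
  then have "card {\<sigma>. \<sigma> permutes S \<and> (\<forall>i\<in>K. \<sigma> i = f i)} = card {\<pi>. \<pi> permutes (S - K)}"
    by (rule bij_betw_same_card [symmetric])
  also have "\<dots> = fact (card S - card K)"
    using fin K by (intro card_permutations) (auto simp: card_Diff_subset finite_subset)
  finally show ?thesis .
qed

text \<open>
  Expanding each product \<open>\<Prod>i. 1 + w (i, \<sigma> i)\<close> gives one term for each set of edges of the graph of
  \<open>\<sigma>\<close>.  Such a set is a matching, and a matching with \<open>k\<close> edges lies in the graphs of \<open>fact (n - k)\<close>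
  permutations.
\<close>
lemma permanent_eq_matchings:
  "permanent n (\<lambda>i j. 1 + w (i, j))
     = (\<Sum>M\<in>matchings {1..n} {1..n}. fact (n - card M) * (\<Prod>e\<in>M. w e))"
proof -
  define P where "P = {\<sigma>. \<sigma> permutes {1..n}}"
  define graph where "graph \<sigma> = (\<lambda>i. (i, \<sigma> i)) ` {1..n}" for \<sigma> :: "nat \<Rightarrow> nat"
  have finP: "finite P" by (simp add: P_def finite_permutations)
  have "permanent n (\<lambda>i j. 1 + w (i, j)) = (\<Sum>\<sigma>\<in>P. \<Prod>e\<in>graph \<sigma>. w e + 1)"
    unfolding permanent_def P_def graph_def
    by (intro sum.cong refl, subst prod.reindex) (auto simp: inj_on_def add.commute)
  also have "\<dots> = (\<Sum>\<sigma>\<in>P. \<Sum>M\<in>Pow (graph \<sigma>). \<Prod>e\<in>M. w e)"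
    by (intro sum.cong refl, subst prod_add) (auto simp: graph_def)
  also have "\<dots> = (\<Sum>\<sigma>\<in>P. \<Sum>M | M \<in> matchings {1..n} {1..n} \<and> M \<subseteq> graph \<sigma>. \<Prod>e\<in>M. w e)"
  proof (intro sum.cong refl)
    fix \<sigma> assume "\<sigma> \<in> P"
    then have \<sigma>: "\<sigma> permutes {1..n}" by (simp add: P_def)
    then have "graph \<sigma> \<in> matchings {1..n} {1..n}"
      using permutes_inj[OF \<sigma>] permutes_in_image[OF \<sigma>]
      by (auto simp: graph_def matchings_def inj_on_def)
    then show "Pow (graph \<sigma>) = {M. M \<in> matchings {1..n} {1..n} \<and> M \<subseteq> graph \<sigma>}"
      by (auto simp: matchings_def intro: inj_on_subset)
  qed
  also have "\<dots> = (\<Sum>M\<in>matchings {1..n} {1..n}. \<Sum>\<sigma> | \<sigma> \<in> P \<and> M \<subseteq> graph \<sigma>. \<Prod>e\<in>M. w e)"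
    by (rule sum.swap_restrict) (auto simp: finP finite_matchings)
  also have "\<dots> = (\<Sum>M\<in>matchings {1..n} {1..n}. fact (n - card M) * (\<Prod>e\<in>M. w e))"
  proof (intro sum.cong refl)
    fix M assume M: "M \<in> matchings {1..n} {1..n}"
    define f where "f i = (THE j. (i, j) \<in> M)" for i
    have inj: "inj_on fst M" "inj_on snd M" and sub: "M \<subseteq> {1..n} \<times> {1..n}"
      using M by (auto simp: matchings_def)
    have f: "f i = j" if "(i, j) \<in> M" for i j
      unfolding f_def
    proof (rule the_equality)
      fix j' assume "(i, j') \<in> M"
      then show "j' = j" using inj_onD[OF inj(1), of "(i, j')" "(i, j)"] that by simp
    qed fact
    have "{\<sigma> \<in> P. M \<subseteq> graph \<sigma>} = {\<sigma>. \<sigma> permutes {1..n} \<and> (\<forall>i\<in>fst ` M. \<sigma> i = f i)}"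
      using f sub by (fastforce simp: P_def graph_def)
    moreover have "inj_on f (fst ` M)"
    proof (rule inj_onI)
      fix x y assume "x \<in> fst ` M" "y \<in> fst ` M" and eq: "f x = f y"
      then obtain a b where ab: "(x, a) \<in> M" "(y, b) \<in> M" by auto
      with f eq have "a = b" by metis
      with ab show "x = y" using inj_onD[OF inj(2), of "(x, a)" "(y, b)"] by simp
    qed
    moreover have "fst ` M \<subseteq> {1..n}" "f ` fst ` M \<subseteq> {1..n}"
      using f sub by fastforce+
    ultimately have "card {\<sigma> \<in> P. M \<subseteq> graph \<sigma>} = fact (n - card M)"
      using card_permutations_extending[of "{1..n}" "fst ` M" f] by (simp add: card_image inj)
    then show "(\<Sum>\<sigma> | \<sigma> \<in> P \<and> M \<subseteq> graph \<sigma>. \<Prod>e\<in>M. w e) = fact (n - card M) * (\<Prod>e\<in>M. w e)"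
      by simp
  qed
  finally show ?thesis .
qed

section \<open>Zero-free regions of the permanent\<close>

text \<open>
  The permanent of \<open>Z\<close> is the composition, in the sense of Szego, of the matching polynomial of
  \<open>(Z - J) / R\<close>, where \<open>J\<close> is the all-ones matrix, with the truncated exponential series in \<open>R * z\<close>: the numbers \<open>fact (n - k)\<close> are
  exactly what the composition produces from the coefficients \<open>R ^ k / fact k\<close>.  Neither factor
  vanishes in the closed unit disc.
\<close>
lemma permanent_nonzero:
  assumes n: "n \<ge> 1" and R: "R > 0" and small: "R ^ Suc n * exp R < fact (Suc n)"
    and Z: "Z \<in> near_ones n (R / (4 * real n))"
  shows "permanent n Z \<noteq> 0"
proof -
  let ?I = "{1..n}"
  define w where "w e = (Z (fst e) (snd e) - 1) / of_real R" for e
  define f where "f = (\<Sum>M\<in>matchings ?I ?I. monom (\<Prod>e\<in>M. w e) (card M))"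
  define g where "g = (\<Sum>k\<le>n. monom (of_real R ^ k / fact k :: complex) k)"
  have fin: "finite (matchings ?I ?I)" by (simp add: finite_matchings)
  have card_le: "card M \<le> n" if "M \<in> matchings ?I ?I" for M
    using card_matching_le[OF that] by simp
  have norm_w: "norm (w (i, j)) = norm (1 - Z i j) / R" for i j
    using R by (simp add: w_def norm_divide norm_minus_commute)
  have rows: "(\<Sum>j\<in>?I. norm (w (i, j))) \<le> 1 / 4" if "i \<in> ?I" for i
  proof -
    have "(\<Sum>j\<in>?I. norm (1 - Z i j)) \<le> R / (4 * real n) * real n"
      using Z that unfolding near_ones_def by blast
    also have "\<dots> = R / 4" using n by simp
    finally show ?thesis using R by (simp add: norm_w sum_divide_distrib [symmetric] field_simps)
  qed
  have cols: "(\<Sum>i\<in>?I. norm (w (i, j))) \<le> 1 / 4" if "j \<in> ?I" for j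
  proof -
    have "(\<Sum>i\<in>?I. norm (1 - Z i j)) \<le> R / (4 * real n) * real n"
      using Z that unfolding near_ones_def by blast
    also have "\<dots> = R / 4" using n by simp
    finally show ?thesis using R by (simp add: norm_w sum_divide_distrib [symmetric] field_simps)
  qed
  have "degree f \<le> n"
    unfolding f_def by (intro degree_sum_le fin) (metis card_le degree_monom_le order_trans)
  have f_nz: "poly f z \<noteq> 0" if z: "norm z \<le> 1" for z
  proof -
    have le: "norm (z * w e) \<le> norm (w e)" for e
      using z by (simp add: norm_mult mult_left_le_one_le)
    have "poly f z = matching_sum (\<lambda>e. z * w e) ?I ?I"
      by (simp add: f_def poly_sum poly_monom matching_sum_def prod.distrib mult.commute)
    moreover have "matching_sum (\<lambda>e. z * w e) ?I ?I \<noteq> 0"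
    proof (rule matching_sum_nonzero)
      show "(\<Sum>j\<in>?I. norm (z * w (i, j))) \<le> 1 / 4" if "i \<in> ?I" for i
        using sum_mono[OF le] rows[OF that] by (rule order_trans)
      show "(\<Sum>i\<in>?I. norm (z * w (i, j))) \<le> 1 / 4" if "j \<in> ?I" for j
        using sum_mono[OF le] cols[OF that] by (rule order_trans)
    qed simp_all
    ultimately show ?thesis by simp
  qed
  have coeff_g: "coeff g k = (if k \<le> n then of_real R ^ k / fact k else 0)" for k
    by (simp add: g_def coeff_sum coeff_monom)
  have "degree g \<le> n" by (rule degree_le) (simp add: coeff_g)
  moreover have g0: "coeff g 0 = 1" by (simp add: coeff_g)
  ultimately obtain \<zeta> where "g = smult (coeff g 0) (\<Prod>l<n. [:1, \<zeta> l:])"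
    using poly_eq_prod_one_plus[of g n] by auto
  then have \<zeta>: "g = smult 1 (\<Prod>l<n. [:1, \<zeta> l:])" by (simp only: g0)
  have g_nz: "poly g z \<noteq> 0" if z: "norm z \<le> 1" for z
  proof -
    have le: "norm (of_real R * z) \<le> R" using R z by (simp add: norm_mult mult_left_le)
    then have "norm (of_real R * z) ^ Suc n * exp (norm (of_real R * z)) \<le> R ^ Suc n * exp R"
      using R by (intro mult_mono power_mono) auto
    then have "(\<Sum>k\<le>n. (of_real R * z) ^ k / fact k) \<noteq> 0"
      using small by (intro exp_partial_sum_nonzero) (rule order.strict_trans1)
    then show ?thesis
      by (simp add: g_def poly_sum poly_monom power_mult_distrib)
  qed
  have "norm (\<zeta> l) \<le> 1" if "l < n" for l
  proof (rule ccontr)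
    assume "\<not> norm (\<zeta> l) \<le> 1"
    then have "\<zeta> l \<noteq> 0" "norm (- 1 / \<zeta> l) \<le> 1" by (auto simp: norm_divide divide_simps)
    with one_plus_factor_zero[OF \<zeta> that] g_nz show False by blast
  qed
  with \<open>degree f \<le> n\<close> f_nz have
    "(\<Sum>k\<le>n. fact k * fact (n - k) * coeff f k * coeff (\<Prod>l<n. [:1, \<zeta> l:]) k) \<noteq> 0"
    by (intro szegoe_composition)
  moreover have "(\<Prod>l<n. [:1, \<zeta> l:]) = g" using \<zeta> by simp
  moreover have "(\<Sum>k\<le>n. fact k * fact (n - k) * coeff f k * coeff g k)
      = (\<Sum>k\<le>n. \<Sum>M\<in>matchings ?I ?I.
          if card M = k then fact (n - card M) * (of_real R ^ card M * (\<Prod>e\<in>M. w e)) else 0)"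
  proof (intro sum.cong refl)
    fix k assume "k \<in> {..n}"
    then have "fact k * fact (n - k) * coeff f k * coeff g k
        = fact (n - k) * of_real R ^ k * coeff f k"
      by (simp add: coeff_g)
    also have "\<dots> = (\<Sum>M\<in>matchings ?I ?I.
        if card M = k then fact (n - card M) * (of_real R ^ card M * (\<Prod>e\<in>M. w e)) else 0)"
      by (simp add: f_def coeff_sum coeff_monom sum_distrib_left)
        (intro sum.cong refl, simp)
    finally show "fact k * fact (n - k) * coeff f k * coeff g k = (\<Sum>M\<in>matchings ?I ?I.
        if card M = k then fact (n - card M) * (of_real R ^ card M * (\<Prod>e\<in>M. w e)) else 0)" .
  qed
  moreover have "\<dots> = (\<Sum>M\<in>matchings ?I ?I. \<Sum>k\<le>n.
      if card M = k then fact (n - card M) * (of_real R ^ card M * (\<Prod>e\<in>M. w e)) else 0)"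
    by (rule sum.swap)
  moreover have "\<dots> = (\<Sum>M\<in>matchings ?I ?I. fact (n - card M) * (\<Prod>e\<in>M. of_real R * w e))"
    by (intro sum.cong refl) (simp add: card_le prod.distrib)
  moreover have "\<dots> = permanent n (\<lambda>i j. 1 + of_real R * w (i, j))"
    by (rule permanent_eq_matchings [symmetric])
  moreover have "(\<lambda>i j. 1 + of_real R * w (i, j)) = Z"
    using R by (simp add: w_def fun_eq_iff)
  ultimately show ?thesis by simp
qed

lemma alpha_pos: "alpha > 0"
  using alpha_eq by (metis exp_gt_zero zero_less_mult_pos2 zero_less_one)

lemma alpha_le_half: "alpha \<le> 1 / 2"
proof (rule ccontr)
  assume "\<not> alpha \<le> 1 / 2"
  then have a: "alpha > 1 / 2" by simp
  have "2 < 1 + (1 + alpha)" using a by simp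
  also have "\<dots> \<le> exp (1 + alpha)" by (rule exp_ge_add_one_self)
  finally have "1 / 2 * 2 < alpha * exp (1 + alpha)" using a by (intro mult_strict_mono) auto
  then show False by (simp add: alpha_eq)
qed

lemma power_self_le_fact_exp: "real n ^ n \<le> fact n * exp (real n)"
proof -
  have "(\<Sum>k\<in>{n}. real n ^ k /\<^sub>R fact k) \<le> suminf (\<lambda>k. real n ^ k /\<^sub>R fact k)"
    by (rule sum_le_suminf[OF summable_exp_generic]) auto
  then have "real n ^ n / fact n \<le> exp (real n)" by (simp add: exp_def divide_inverse mult.commute)
  then show ?thesis by (simp add: field_simps)
qed

text \<open>
  The equation for \<open>alpha\<close> says that \<open>- alpha\<close> lies on the Szego curve, the part of
  \<open>norm (z * exp (1 - z)) = 1\<close> in the unit disc, to which the zeros of the truncated exponential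
  series in \<open>n * z\<close> converge.  It is the point of the curve nearest to the origin.  In the proof the
  equation enters as \<open>alpha * exp alpha = exp (- 1)\<close>, whose \<open>n\<close>-th power cancels the growth in
  \<open>n ^ n \<le> fact n * exp n\<close>.
\<close>
lemma alpha_bound:
  assumes "n \<ge> 1"
  shows "(alpha * real n) ^ Suc n * exp (alpha * real n) < fact (Suc n)"
proof -
  have "exp 1 * (alpha * exp alpha) = 1" using alpha_eq by (simp add: exp_add mult_ac)
  then have e: "alpha * exp alpha = 1 / exp 1" by (simp add: field_simps)
  have "(alpha * real n) ^ Suc n * exp (alpha * real n)
      = alpha * real n * (real n ^ n * (alpha * exp alpha) ^ n)"
    by (simp add: power_mult_distrib exp_of_nat2_mult mult_ac)
  also have "(alpha * exp alpha) ^ n = 1 / exp (real n)"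
    by (simp add: e power_one_over exp_of_nat_mult [of n 1, simplified])
  also have "real n ^ n * (1 / exp (real n)) \<le> fact n"
    using power_self_le_fact_exp[of n] by (simp add: field_simps)
  also have "alpha * real n * fact n < real (Suc n) * fact n"
  proof -
    have "alpha * real n \<le> 1 * real n" using alpha_le_half by (intro mult_right_mono) auto
    then show ?thesis by (intro mult_strict_right_mono) auto
  qed
  finally show ?thesis using alpha_pos by (simp add: mult_left_mono)
qed

lemma permanent_nonzero_alpha:
  assumes "n \<ge> 1" "Z \<in> near_ones n (alpha / 4)"
  shows "permanent n Z \<noteq> 0"
proof -
  have "alpha / 4 = alpha * real n / (4 * real n)" using assms(1) by simp
  then show ?thesis
    using permanent_nonzero[of n "alpha * real n" Z] alpha_bound[of n] alpha_pos assms by simp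
qed

text \<open>
  Some room beyond \<open>alpha / 4\<close>, depending on \<open>n\<close>, makes expansions around the all-ones matrix
  converge uniformly on the closed region given by \<open>alpha / 4\<close>.
\<close>
lemma permanent_nonzero_beyond_alpha:
  assumes "n \<ge> 1"
  obtains s where "s > alpha / 4" "\<And>Z. Z \<in> near_ones n s \<Longrightarrow> permanent n Z \<noteq> 0"
proof -
  define \<phi> where "\<phi> R = R ^ Suc n * exp R" for R :: real
  have "continuous (at_right (alpha * real n)) \<phi>"
    unfolding \<phi>_def by (intro continuous_intros)
  then have "(\<phi> \<longlongrightarrow> \<phi> (alpha * real n)) (at_right (alpha * real n))"
    by (simp add: continuous_within)
  then have "\<forall>\<^sub>F R in at_right (alpha * real n). \<phi> R < fact (Suc n)"
    by (rule order_tendstoD) (simp only: \<phi>_def alpha_bound[OF assms])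
  then obtain b where b: "b > alpha * real n"
    "\<And>R. alpha * real n < R \<Longrightarrow> R < b \<Longrightarrow> \<phi> R < fact (Suc n)"
    by (auto simp: eventually_at_right_field)
  then obtain R where R: "alpha * real n < R" "R < b" using dense by blast
  have Rpos: "R > 0" using R(1) alpha_pos by (smt (verit) mult_nonneg_nonneg of_nat_0_le_iff)
  show thesis
  proof (rule that)
    show "alpha / 4 < R / (4 * real n)" using R(1) assms by (simp add: field_simps)
    show "permanent n Z \<noteq> 0" if "Z \<in> near_ones n (R / (4 * real n))" for Z
      by (rule permanent_nonzero[OF assms Rpos b(2)[OF R, unfolded \<phi>_def] that])
  qed
qed

text \<open>For a single entry the permanent is that entry, and the region is much larger.\<close>
lemma permanent_one_nonzero:
  assumes "Z \<in> near_ones 1 (1 / 2)"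
  shows "permanent 1 Z \<noteq> 0"
proof -
  have "{\<sigma>. \<sigma> permutes {1..1::nat}} = {id}" by simp
  then have "permanent 1 Z = Z 1 1" unfolding permanent_def by simp
  moreover have "norm (1 - Z 1 1) \<le> 1 / 2" using assms by (simp add: near_ones_def)
  ultimately show ?thesis by auto
qed

section \<open>The logarithmic derivative along segments\<close>

text \<open>The permanent on the line through the all-ones matrix and \<open>Z\<close>.\<close>
definition line_poly :: "nat \<Rightarrow> (nat \<Rightarrow> nat \<Rightarrow> complex) \<Rightarrow> complex poly" where
  "line_poly n Z = (\<Sum>M\<in>matchings {1..n} {1..n}.
     monom (fact (n - card M) * (\<Prod>e\<in>M. Z (fst e) (snd e) - 1)) (card M))"

lemma poly_line_poly: "poly (line_poly n Z) z = permanent n (\<lambda>i j. 1 + z * (Z i j - 1))"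
proof -
  have "poly (line_poly n Z) z = (\<Sum>M\<in>matchings {1..n} {1..n}.
      fact (n - card M) * (\<Prod>e\<in>M. z * (Z (fst e) (snd e) - 1)))"
    by (simp add: line_poly_def poly_sum poly_monom prod.distrib mult_ac)
  also have "\<dots> = permanent n (\<lambda>i j. 1 + z * (Z i j - 1))"
    using permanent_eq_matchings[of n "\<lambda>e. z * (Z (fst e) (snd e) - 1)"] by simp
  finally show ?thesis .
qed

lemma coeff_line_poly:
  "coeff (line_poly n Z) k = (\<Sum>M\<in>matchings {1..n} {1..n}.
     if card M = k then fact (n - card M) * (\<Prod>e\<in>M. Z (fst e) (snd e) - 1) else 0)"
  by (simp add: line_poly_def coeff_sum coeff_monom)

lemma permanent_ones: "permanent n (\<lambda>i j. 1) = fact n"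
  by (simp add: permanent_def card_permutations)

lemma coeff_0_line_poly: "coeff (line_poly n Z) 0 = fact n"
  using poly_line_poly[of n Z 0] by (simp add: poly_0_coeff_0 permanent_ones)

lemma degree_line_poly: "degree (line_poly n Z) \<le> n"
proof (rule degree_le, intro allI impI)
  fix k assume "n < k"
  then have "card M \<noteq> k" if "M \<in> matchings {1..n} {1..n}" for M
    using card_matching_le[OF that] by auto
  then show "coeff (line_poly n Z) k = 0"
    unfolding coeff_line_poly by (intro sum.neutral ballI) simp
qed

definition log_deriv_coeff :: "nat \<Rightarrow> (nat \<Rightarrow> nat \<Rightarrow> complex) \<Rightarrow> nat \<Rightarrow> complex" where
  "log_deriv_coeff n Z = fps_nth
     (fps_deriv (fps_of_poly (line_poly n Z)) * inverse (fps_of_poly (line_poly n Z)))"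

text \<open>
  The recursion expresses the coefficients of the logarithmic derivative through entries of \<open>Z\<close>.
  It is the source of their polynomial dependence on \<open>Z\<close>, and with it of their continuity and of
  their being real for real \<open>Z\<close>.
\<close>
lemma log_deriv_coeff_rec:
  "log_deriv_coeff n Z k = (of_nat (Suc k) * coeff (line_poly n Z) (Suc k)
     - (\<Sum>i<k. log_deriv_coeff n Z i * coeff (line_poly n Z) (k - i))) / fact n"
proof -
  define P where "P = fps_of_poly (line_poly n Z)"
  define D where "D = fps_deriv P * inverse P"
  have D: "log_deriv_coeff n Z = fps_nth D"
    by (simp add: log_deriv_coeff_def D_def P_def)
  have P0: "fps_nth P 0 = fact n" by (simp add: P_def coeff_0_line_poly)
  then have "inverse P * P = 1" by (intro inverse_mult_eq_1) simp
  then have "D * P = fps_deriv P" by (simp add: D_def mult.assoc)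
  then have "of_nat (Suc k) * fps_nth P (Suc k) = fps_nth (D * P) k" by simp
  also have "\<dots> = (\<Sum>i\<le>k. fps_nth D i * fps_nth P (k - i))"
    by (simp add: fps_mult_nth atLeast0AtMost)
  also have "\<dots> = (\<Sum>i<k. fps_nth D i * fps_nth P (k - i)) + fps_nth D k * fact n"
    by (simp add: lessThan_Suc_atMost [symmetric] P0)
  finally have "fps_nth D k = (of_nat (Suc k) * fps_nth P (Suc k)
      - (\<Sum>i<k. fps_nth D i * fps_nth P (k - i))) / fact n"
    by (simp add: field_simps)
  then show ?thesis by (simp add: D P_def)
qed

lemma fps_deriv_prod_one_plus:
  fixes r :: "nat \<Rightarrow> complex"
  shows "fps_deriv (fps_of_poly (\<Prod>l<n. [:1, r l:]))
    = fps_of_poly (\<Prod>l<n. [:1, r l:]) * Abs_fps (\<lambda>k. \<Sum>l<n. (- 1) ^ k * r l ^ Suc k)"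
proof (induction n)
  case 0
  show ?case by (simp add: fps_zero_def [symmetric])
next
  case (Suc n)
  define Q where "Q = fps_of_poly (\<Prod>l<n. [:1, r l:])"
  define H where "H = Abs_fps (\<lambda>k. \<Sum>l<n. (- 1) ^ k * r l ^ Suc k)"
  define G where "G = Abs_fps (\<lambda>k. (- 1) ^ k * r n ^ Suc k)"
  define F where "F = fps_of_poly [:1, r n:]"
  have F: "F = 1 + fps_const (r n) * fps_X" by (simp add: F_def fps_of_poly_linear')
  have FG: "F * G = fps_const (r n)"
  proof (rule fps_ext)
    fix k
    have "fps_nth (F * G) k = fps_nth G k + r n * (if k = 0 then 0 else fps_nth G (k - 1))"
      by (simp add: F distrib_right mult.assoc)
    then show "fps_nth (F * G) k = fps_nth (fps_const (r n)) k"
      by (cases k) (simp_all add: G_def)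
  qed
  have F': "fps_deriv F = fps_const (r n)" by (simp add: F)
  have "Abs_fps (\<lambda>k. \<Sum>l<Suc n. (- 1) ^ k * r l ^ Suc k) = H + G"
    by (rule fps_ext) (simp add: H_def G_def)
  moreover have "fps_of_poly (\<Prod>l<Suc n. [:1, r l:]) = Q * F"
    by (simp only: prod.lessThan_Suc fps_of_poly_mult Q_def F_def)
  moreover have "fps_deriv (Q * F) = Q * F * (H + G)"
  proof -
    have "fps_deriv Q = Q * H" using Suc.IH by (simp only: Q_def H_def)
    then have "fps_deriv (Q * F) = Q * (F * G) + Q * H * F" by (simp add: F' FG)
    then show ?thesis by (simp add: algebra_simps)
  qed
  ultimately show ?case by simp
qed

lemma log_deriv_coeff_factors:
  assumes "line_poly n Z = smult (fact n) (\<Prod>l<n. [:1, \<rho> l:])"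
  shows "log_deriv_coeff n Z k = (\<Sum>l<n. (- 1) ^ k * \<rho> l ^ Suc k)"
proof -
  define P where "P = fps_of_poly (line_poly n Z)"
  define Q where "Q = fps_of_poly (\<Prod>l<n. [:1, \<rho> l:])"
  define H where "H = Abs_fps (\<lambda>k. \<Sum>l<n. (- 1) ^ k * \<rho> l ^ Suc k)"
  have P: "P = fps_const (fact n) * Q" by (simp add: P_def Q_def assms fps_of_poly_smult)
  have "fps_deriv Q = Q * H" unfolding Q_def H_def by (rule fps_deriv_prod_one_plus)
  then have "fps_deriv P = H * P" by (simp add: P mult_ac)
  moreover have "P * inverse P = 1"
    by (rule inverse_mult_eq_1') (simp add: P_def coeff_0_line_poly)
  ultimately have "fps_deriv P * inverse P = H" by (simp add: mult.assoc)
  then show ?thesis by (simp add: log_deriv_coeff_def P_def H_def)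
qed

text \<open>
  Moving along the line to the parameter \<open>z\<close> multiplies the row and column sums by \<open>norm z\<close>.  A zero
  therefore needs \<open>norm z * r > s\<close>, and the nonzero \<open>\<rho> l\<close> are the negative inverses of the zeros.
\<close>
lemma line_poly_factors:
  assumes nz: "\<And>Z. Z \<in> near_ones n s \<Longrightarrow> permanent n Z \<noteq> 0"
    and r: "0 \<le> r" "r < s" and Z: "Z \<in> near_ones n r"
  obtains \<rho> where "line_poly n Z = smult (fact n) (\<Prod>l<n. [:1, \<rho> l:])"
    "\<And>l. l < n \<Longrightarrow> norm (\<rho> l) \<le> r / s"
proof -
  have "coeff (line_poly n Z) 0 \<noteq> 0" by (simp add: coeff_0_line_poly)
  from poly_eq_prod_one_plus[OF degree_line_poly this]
  obtain \<rho> where \<rho>: "line_poly n Z = smult (fact n) (\<Prod>l<n. [:1, \<rho> l:])"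
    unfolding coeff_0_line_poly by blast
  have "norm (\<rho> l) \<le> r / s" if l: "l < n" for l
  proof (rule ccontr)
    assume "\<not> norm (\<rho> l) \<le> r / s"
    then have large: "r / s < norm (\<rho> l)" by simp
    then have pos: "norm (\<rho> l) > 0"
      using r by (metis divide_nonneg_pos order_le_less_trans order.strict_trans1)
    then have "\<rho> l \<noteq> 0" by simp
    define z where "z = - 1 / \<rho> l"
    have "norm z * r \<le> s"
      using large pos r by (simp add: z_def norm_divide field_simps)
    then have scale: "norm z * (r * real n) \<le> s * real n"
      by (metis mult.assoc mult_right_mono of_nat_0_le_iff)
    have entry: "norm (1 - (1 + z * (Z i j - 1))) = norm z * norm (1 - Z i j)" for i j
      by (simp add: norm_mult norm_minus_commute)
    have "(\<lambda>i j. 1 + z * (Z i j - 1)) \<in> near_ones n s"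
      unfolding near_ones_def mem_Collect_eq entry sum_distrib_left [symmetric]
    proof (intro conjI ballI)
      fix i assume "i \<in> {1..n}"
      then have "(\<Sum>j = 1..n. norm (1 - Z i j)) \<le> r * real n" using Z by (simp add: near_ones_def)
      then show "norm z * (\<Sum>j = 1..n. norm (1 - Z i j)) \<le> s * real n"
        using scale by (meson mult_left_mono norm_ge_zero order_trans)
    next
      fix j assume "j \<in> {1..n}"
      then have "(\<Sum>i = 1..n. norm (1 - Z i j)) \<le> r * real n" using Z by (simp add: near_ones_def)
      then show "norm z * (\<Sum>i = 1..n. norm (1 - Z i j)) \<le> s * real n"
        using scale by (meson mult_left_mono norm_ge_zero order_trans)
    qed
    then have "poly (line_poly n Z) z \<noteq> 0" unfolding poly_line_poly by (rule nz)
    moreover have "poly (line_poly n Z) z = 0"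
      unfolding z_def by (rule one_plus_factor_zero[OF \<rho> l \<open>\<rho> l \<noteq> 0\<close>])
    ultimately show False by simp
  qed
  with \<rho> that show thesis by blast
qed

lemma norm_log_deriv_coeff_le:
  assumes "\<And>Z. Z \<in> near_ones n s \<Longrightarrow> permanent n Z \<noteq> 0" "0 \<le> r" "r < s" "Z \<in> near_ones n r"
  shows "norm (log_deriv_coeff n Z k / of_nat (Suc k)) \<le> real n * (r / s) ^ Suc k"
proof -
  obtain \<rho> where \<rho>: "line_poly n Z = smult (fact n) (\<Prod>l<n. [:1, \<rho> l:])"
    "\<And>l. l < n \<Longrightarrow> norm (\<rho> l) \<le> r / s"
    using line_poly_factors[OF assms] by metis
  have "norm (log_deriv_coeff n Z k) \<le> (\<Sum>l<n. (r / s) ^ Suc k)"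
    unfolding log_deriv_coeff_factors[OF \<rho>(1)]
  proof (rule sum_norm_le)
    fix l assume "l \<in> {..<n}"
    then show "norm ((- 1) ^ k * \<rho> l ^ Suc k) \<le> (r / s) ^ Suc k"
      using power_mono[OF \<rho>(2)[of l], of "Suc k"]
      by (simp only: norm_mult norm_power norm_minus_cancel norm_one power_one mult_1 lessThan_iff
        norm_ge_zero)
  qed
  also have "\<dots> = real n * (r / s) ^ Suc k" by simp
  finally have "norm (log_deriv_coeff n Z k) \<le> real n * (r / s) ^ Suc k" .
  moreover have "norm (log_deriv_coeff n Z k / of_nat (Suc k)) \<le> norm (log_deriv_coeff n Z k) / 1"
    unfolding norm_divide by (intro divide_left_mono) (simp_all del: of_nat_Suc)
  ultimately show ?thesis by simp
qed

section \<open>A branch of the logarithm of the permanent\<close>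

text \<open>The logarithmic derivative on the segment, integrated term by term from \<open>0\<close> to \<open>1\<close>.\<close>
definition ln_per_series :: "nat \<Rightarrow> (nat \<Rightarrow> nat \<Rightarrow> complex) \<Rightarrow> complex" where
  "ln_per_series n Z = of_real (ln (fact n)) + suminf (\<lambda>k. log_deriv_coeff n Z k / of_nat (Suc k))"

definition ln_per_partial :: "nat \<Rightarrow> nat \<Rightarrow> (nat \<Rightarrow> nat \<Rightarrow> complex) \<Rightarrow> complex" where
  "ln_per_partial n m Z =
     of_real (ln (fact n)) + (\<Sum>k<m. log_deriv_coeff n Z k / of_nat (Suc k))"

lemma exp_ln_per_series:
  assumes "\<And>Z. Z \<in> near_ones n s \<Longrightarrow> permanent n Z \<noteq> 0" "0 \<le> r" "r < s" "Z \<in> near_ones n r"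
  shows "exp (ln_per_series n Z) = permanent n Z"
proof -
  obtain \<rho> where \<rho>: "line_poly n Z = smult (fact n) (\<Prod>l<n. [:1, \<rho> l:])"
    "\<And>l. l < n \<Longrightarrow> norm (\<rho> l) \<le> r / s"
    using line_poly_factors[OF assms] by metis
  have "r / s < 1" using assms(2,3) by simp
  with \<rho>(2) have lt: "norm (\<rho> l) < 1" if "l < n" for l
    using that by (meson order.strict_trans1)
  have "(\<lambda>k. (- 1) ^ k * \<rho> l ^ Suc k / of_nat (Suc k)) sums ln (1 + \<rho> l)" if "l < n" for l
  proof -
    have "(\<lambda>k. - ((- \<rho> l) ^ k) / of_nat k) sums ln (1 + \<rho> l)"
      by (rule Ln_series'[OF lt[OF that]])
    then have "(\<lambda>k. - ((- \<rho> l) ^ Suc k) / of_nat (Suc k)) sums ln (1 + \<rho> l)"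
      by (subst sums_Suc_iff) simp
    moreover have "- ((- \<rho> l) ^ Suc k) = (- 1) ^ k * \<rho> l ^ Suc k" for k
      by (simp add: power_minus[of "\<rho> l" k])
    ultimately show ?thesis by (simp only:)
  qed
  then have "(\<lambda>k. \<Sum>l<n. (- 1) ^ k * \<rho> l ^ Suc k / of_nat (Suc k)) sums (\<Sum>l<n. ln (1 + \<rho> l))"
    by (intro sums_sum) simp
  then have "(\<lambda>k. log_deriv_coeff n Z k / of_nat (Suc k)) sums (\<Sum>l<n. ln (1 + \<rho> l))"
    by (simp only: log_deriv_coeff_factors[OF \<rho>(1)] sum_divide_distrib)
  then have "ln_per_series n Z = of_real (ln (fact n)) + (\<Sum>l<n. ln (1 + \<rho> l))"
    by (simp only: ln_per_series_def sums_iff)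
  also have "exp \<dots> = fact n * (\<Prod>l<n. 1 + \<rho> l)"
  proof -
    have "exp (ln (1 + \<rho> l)) = 1 + \<rho> l" if "l < n" for l
    proof (rule exp_Ln)
      show "1 + \<rho> l \<noteq> 0"
        using lt[OF that] by (metis add_eq_0_iff less_irrefl norm_minus_cancel norm_one)
    qed
    moreover have "exp (of_real (ln (fact n)) :: complex) = fact n"
      by (simp add: exp_of_real)
    ultimately show ?thesis by (simp add: exp_add exp_sum)
  qed
  also have "\<dots> = poly (line_poly n Z) 1" by (simp add: \<rho>(1) poly_prod)
  also have "\<dots> = permanent n Z" by (simp add: poly_line_poly)
  finally show ?thesis .
qed

lemma continuous_log_deriv_coeff:
  "continuous_on (UNIV :: (nat \<Rightarrow> nat \<Rightarrow> complex) set) (\<lambda>Z. log_deriv_coeff n Z k)"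
proof (induction k rule: less_induct)
  case (less k)
  have entry: "continuous_on UNIV (\<lambda>Z :: nat \<Rightarrow> nat \<Rightarrow> complex. Z i j)" for i j
    by (rule continuous_on_product_then_coordinatewise[OF continuous_on_product_coordinates])
  have coeff: "continuous_on UNIV (\<lambda>Z. coeff (line_poly n Z) m)" for m
    unfolding coeff_line_poly
  proof (rule continuous_on_sum)
    fix M :: "(nat \<times> nat) set"
    show "continuous_on UNIV (\<lambda>Z. if card M = m
        then fact (n - card M) * (\<Prod>e\<in>M. Z (fst e) (snd e) - (1::complex)) else 0)"
      by (cases "card M = m") (auto intro!: continuous_intros entry)
  qed
  show ?case
    unfolding log_deriv_coeff_rec[of n _ k]
    by (intro continuous_on_divide continuous_on_diff continuous_on_mult continuous_on_sum
        continuous_on_const coeff less.IH) auto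
qed

lemma log_deriv_coeff_real:
  assumes "\<And>i j. i \<in> {1..n} \<Longrightarrow> j \<in> {1..n} \<Longrightarrow> Z i j \<in> \<real>"
  shows "log_deriv_coeff n Z k \<in> \<real>"
proof (induction k rule: less_induct)
  case (less k)
  have entry: "Z (fst e) (snd e) \<in> \<real>" if "M \<in> matchings {1..n} {1..n}" "e \<in> M" for M e
    using that assms by (auto simp: matchings_def)
  have "coeff (line_poly n Z) m \<in> \<real>" for m
    unfolding coeff_line_poly
  proof (rule sum_in_Reals)
    fix M assume "M \<in> matchings {1..n} {1..n}"
    then have "(\<Prod>e\<in>M. Z (fst e) (snd e) - 1) \<in> \<real>"
      by (intro prod_in_Reals Reals_diff entry) auto
    moreover have "(fact (n - card M) :: complex) \<in> \<real>"
      by (metis Reals_of_real of_real_fact)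
    ultimately show "(if card M = m
        then fact (n - card M) * (\<Prod>e\<in>M. Z (fst e) (snd e) - 1) else 0) \<in> \<real>"
      by (auto intro: Reals_mult)
  qed
  moreover have "(fact n :: complex) \<in> \<real>" by (metis Reals_of_real of_real_fact)
  ultimately show ?case
    unfolding log_deriv_coeff_rec[of n _ k]
    by (intro Reals_divide Reals_diff Reals_mult sum_in_Reals Reals_of_nat less.IH) auto
qed

text \<open>
  The larger zero-free region turns the estimate of the coefficients into a convergent geometric
  majorant which is valid on all of the region given by \<open>alpha / 4\<close>.
\<close>
lemma is_ln_per_branch_series:
  assumes n: "n \<ge> 1"
  shows "is_ln_per_branch n (ln_per_series n)"
proof -
  obtain s where s: "s > alpha / 4" and nz: "\<And>Z. Z \<in> near_ones n s \<Longrightarrow> permanent n Z \<noteq> 0"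
    using permanent_nonzero_beyond_alpha[OF n] by blast
  have \<alpha>: "0 \<le> alpha / 4" using alpha_pos by simp
  define q where "q = alpha / 4 / s"
  have q: "0 \<le> q" "q < 1" using s \<alpha> by (auto simp: q_def)
  have bound: "norm (log_deriv_coeff n Z k / of_nat (Suc k)) \<le> real n * q ^ Suc k"
    if "Z \<in> near_ones n (alpha / 4)" for Z k
    unfolding q_def by (rule norm_log_deriv_coeff_le[OF nz \<alpha> s that])
  have maj: "summable (\<lambda>k. real n * q ^ Suc k)"
    using q by (intro summable_mult) (simp add: summable_mult summable_geometric)
  have "uniform_limit (near_ones n (alpha / 4))
      (\<lambda>m Z. \<Sum>k<m. log_deriv_coeff n Z k / of_nat (Suc k))
      (\<lambda>Z. suminf (\<lambda>k. log_deriv_coeff n Z k / of_nat (Suc k))) sequentially"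
    by (rule Weierstrass_m_test[OF bound maj])
  then have "continuous_on (near_ones n (alpha / 4))
      (\<lambda>Z. suminf (\<lambda>k. log_deriv_coeff n Z k / of_nat (Suc k)))"
  proof (rule uniform_limit_theorem[rotated])
    show "\<forall>\<^sub>F m in sequentially. continuous_on (near_ones n (alpha / 4))
        (\<lambda>Z. \<Sum>k<m. log_deriv_coeff n Z k / of_nat (Suc k))"
      by (intro always_eventually allI continuous_on_sum continuous_on_divide continuous_on_const
          continuous_on_subset[OF continuous_log_deriv_coeff]) (auto simp del: of_nat_Suc)
  qed simp
  then have cont: "continuous_on (near_ones n (alpha / 4)) (ln_per_series n)"
    unfolding ln_per_series_def by (intro continuous_on_add continuous_on_const)
  have real: "ln_per_series n Z \<in> \<real>"
    if Z: "Z \<in> near_ones n (alpha / 4)" and ent: "\<forall>i\<in>{1..n}. \<forall>j\<in>{1..n}. Z i j \<in> \<real>" for Z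
  proof -
    have "summable (\<lambda>k. log_deriv_coeff n Z k / of_nat (Suc k))"
      by (rule summable_comparison_test'[OF maj, of 0]) (rule bound[OF Z])
    then have "(\<lambda>m. \<Sum>k<m. log_deriv_coeff n Z k / of_nat (Suc k))
        \<longlonglongrightarrow> suminf (\<lambda>k. log_deriv_coeff n Z k / of_nat (Suc k))"
      by (rule summable_LIMSEQ)
    then have "suminf (\<lambda>k. log_deriv_coeff n Z k / of_nat (Suc k)) \<in> \<real>"
    proof (rule closed_sequentially[OF closed_complex_Reals, rotated])
      show "(\<Sum>k<m. log_deriv_coeff n Z k / of_nat (Suc k)) \<in> \<real>" for m
        using ent by (intro sum_in_Reals Reals_divide Reals_of_nat log_deriv_coeff_real) auto
    qed
    then show ?thesis unfolding ln_per_series_def by (intro Reals_add) auto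
  qed
  have "exp (ln_per_series n Z) = permanent n Z" if "Z \<in> near_ones n (alpha / 4)" for Z
    by (rule exp_ln_per_series[OF nz \<alpha> s that])
  with cont real show ?thesis unfolding is_ln_per_branch_def by blast
qed

text \<open>
  On the segment from the all-ones matrix, two branches differ by a continuous function with
  values in \<open>2 * pi * \<i> * \<int>\<close>.  It vanishes at the all-ones matrix, where both values are real.
\<close>
lemma ln_per_branch_unique:
  assumes L: "is_ln_per_branch n L" and L': "is_ln_per_branch n L'"
    and A: "A \<in> near_ones n (alpha / 4)"
  shows "L A = L' A"
proof -
  define D where "D = near_ones n (alpha / 4)"
  define \<gamma> where "\<gamma> t = (\<lambda>i j. 1 + of_real t * (A i j - 1))" for t :: real
  have \<gamma>D: "\<gamma> t \<in> D" if t: "t \<in> {0..1}" for t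
  proof -
    have le: "norm (1 - \<gamma> t i j) \<le> norm (1 - A i j)" for i j
    proof -
      have "norm (1 - \<gamma> t i j) = t * norm (1 - A i j)"
        using t by (simp add: \<gamma>_def norm_mult norm_minus_commute)
      also have "\<dots> \<le> norm (1 - A i j)" using t by (simp add: mult_left_le_one_le)
      finally show ?thesis .
    qed
    show ?thesis
      unfolding D_def near_ones_def mem_Collect_eq
    proof (intro conjI ballI)
      fix i assume "i \<in> {1..n}"
      then have "(\<Sum>j = 1..n. norm (1 - A i j)) \<le> alpha / 4 * real n"
        using A unfolding near_ones_def by blast
      then show "(\<Sum>j = 1..n. norm (1 - \<gamma> t i j)) \<le> alpha / 4 * real n"
        by (rule order_trans[OF sum_mono[OF le]])
    next
      fix j assume "j \<in> {1..n}"
      then have "(\<Sum>i = 1..n. norm (1 - A i j)) \<le> alpha / 4 * real n"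
        using A unfolding near_ones_def by blast
      then show "(\<Sum>i = 1..n. norm (1 - \<gamma> t i j)) \<le> alpha / 4 * real n"
        by (rule order_trans[OF sum_mono[OF le]])
    qed
  qed
  have cont\<gamma>: "continuous_on {0..1} \<gamma>"
    unfolding \<gamma>_def by (intro continuous_intros)
  have cont: "continuous_on {0..1} (\<lambda>t. L (\<gamma> t) - L' (\<gamma> t))"
  proof (rule continuous_on_diff)
    have sub: "\<gamma> ` {0..1} \<subseteq> D" using \<gamma>D by blast
    show "continuous_on {0..1} (\<lambda>t. L (\<gamma> t))"
      using L unfolding is_ln_per_branch_def D_def [symmetric]
      by (intro continuous_on_compose2[OF _ cont\<gamma> sub]) blast
    show "continuous_on {0..1} (\<lambda>t. L' (\<gamma> t))"
      using L' unfolding is_ln_per_branch_def D_def [symmetric]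
      by (intro continuous_on_compose2[OF _ cont\<gamma> sub]) blast
  qed
  have exp_eq: "exp (L (\<gamma> t)) = exp (L' (\<gamma> t))" if "t \<in> {0..1}" for t
    using \<gamma>D[OF that] L L' unfolding is_ln_per_branch_def D_def [symmetric] by simp
  have "(\<lambda>t. L (\<gamma> t) - L' (\<gamma> t)) constant_on {0..1}"
  proof (rule continuous_discrete_range_constant[OF _ cont])
    show "connected {0..1::real}" by simp
    fix x :: real assume x: "x \<in> {0..1}"
    have "L (\<gamma> y) - L' (\<gamma> y) = L (\<gamma> x) - L' (\<gamma> x)"
      if y: "y \<in> {0..1}" and lt: "norm (L (\<gamma> y) - L' (\<gamma> y) - (L (\<gamma> x) - L' (\<gamma> x))) < 2 * pi" for y
    proof (rule exp_complex_eqI)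
      show "\<bar>Im (L (\<gamma> y) - L' (\<gamma> y)) - Im (L (\<gamma> x) - L' (\<gamma> x))\<bar> < 2 * pi"
        using lt abs_Im_le_cmod[of "L (\<gamma> y) - L' (\<gamma> y) - (L (\<gamma> x) - L' (\<gamma> x))"] by simp
      show "exp (L (\<gamma> y) - L' (\<gamma> y)) = exp (L (\<gamma> x) - L' (\<gamma> x))"
        using exp_eq[OF x] exp_eq[OF y] by (simp add: exp_diff)
    qed
    then show "\<exists>e>0. \<forall>y. y \<in> {0..1} \<and> L (\<gamma> y) - L' (\<gamma> y) \<noteq> L (\<gamma> x) - L' (\<gamma> x)
        \<longrightarrow> e \<le> norm (L (\<gamma> y) - L' (\<gamma> y) - (L (\<gamma> x) - L' (\<gamma> x)))"
      by (intro exI[of _ "2 * pi"]) (auto simp: not_less [symmetric])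
  qed
  then have "L (\<gamma> 1) - L' (\<gamma> 1) = L (\<gamma> 0) - L' (\<gamma> 0)"
    unfolding constant_on_def by (metis atLeastAtMost_iff order_refl zero_le_one)
  moreover have "L (\<gamma> 0) = L' (\<gamma> 0)"
  proof -
    have 0: "\<gamma> 0 \<in> D" by (rule \<gamma>D) simp
    have "\<forall>i\<in>{1..n}. \<forall>j\<in>{1..n}. \<gamma> 0 i j \<in> \<real>" by (simp add: \<gamma>_def)
    then have "L (\<gamma> 0) \<in> \<real>" "L' (\<gamma> 0) \<in> \<real>"
      using 0 L L' unfolding is_ln_per_branch_def D_def [symmetric] by blast+
    then obtain x y where "L (\<gamma> 0) = of_real x" "L' (\<gamma> 0) = of_real y"
      by (elim Reals_cases)
    moreover have "exp (L (\<gamma> 0)) = exp (L' (\<gamma> 0))" by (rule exp_eq) simp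
    ultimately show ?thesis by (simp add: exp_of_real)
  qed
  moreover have "\<gamma> 1 = A" by (simp add: \<gamma>_def)
  ultimately show ?thesis by simp
qed

lemma ln_per_eq_series:
  assumes "n \<ge> 1" "A \<in> near_ones n (alpha / 4)"
  shows "ln_per n A = ln_per_series n A"
proof -
  have series: "is_ln_per_branch n (ln_per_series n)" by (rule is_ln_per_branch_series[OF assms(1)])
  then have "is_ln_per_branch n (ln_per n)" unfolding ln_per_def
    by (rule someI[of "is_ln_per_branch n"])
  then show ?thesis using series assms(2) by (rule ln_per_branch_unique)
qed

lemma near_ones_mono:
  assumes "r \<le> s"
  shows "near_ones n r \<subseteq> near_ones n s"
proof -
  have "r * real n \<le> s * real n" using assms by (intro mult_right_mono) auto
  then show ?thesis unfolding near_ones_def by (blast intro: order_trans)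
qed

lemma ln_per_partial_error:
  assumes n: "n \<ge> 1" and nz: "\<And>Z. Z \<in> near_ones n s \<Longrightarrow> permanent n Z \<noteq> 0"
    and r: "0 \<le> r" "r < s" "r \<le> alpha / 4" and A: "A \<in> near_ones n r"
  shows "norm (ln_per n A - ln_per_partial n m A) \<le> real n * (r / s) ^ Suc m / (1 - r / s)"
proof -
  define q where "q = r / s"
  have q: "0 \<le> q" "q < 1" using r by (auto simp: q_def)
  define a where "a k = log_deriv_coeff n A k / of_nat (Suc k)" for k
  have bound: "norm (a k) \<le> real n * q ^ Suc k" for k
    unfolding q_def a_def by (rule norm_log_deriv_coeff_le[OF nz r(1,2) A])
  have geo: "(\<lambda>k. real n * q ^ Suc m * q ^ k) sums (real n * q ^ Suc m * (1 / (1 - q)))"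
    using q by (intro sums_mult geometric_sums) simp
  have maj: "summable (\<lambda>k. real n * q ^ Suc k)"
    using q by (intro summable_mult) (simp add: summable_mult summable_geometric)
  have sum: "summable a"
    by (rule summable_comparison_test'[OF maj, of 0]) (rule bound)
  have r\<alpha>: "near_ones n r \<subseteq> near_ones n (alpha / 4)" using r(3) by (rule near_ones_mono)
  have "ln_per n A = of_real (ln (fact n)) + suminf a"
    using ln_per_eq_series[OF n] A r\<alpha> unfolding ln_per_series_def a_def by blast
  then have "ln_per n A - ln_per_partial n m A = suminf a - (\<Sum>k<m. a k)"
    by (simp add: ln_per_partial_def a_def)
  also have "\<dots> = suminf (\<lambda>k. a (k + m))" using suminf_minus_initial_segment[OF sum] by simp
  finally have "norm (ln_per n A - ln_per_partial n m A) = norm (suminf (\<lambda>k. a (k + m)))" by simp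
  also have "\<dots> \<le> suminf (\<lambda>k. real n * q ^ Suc m * q ^ k)"
  proof (rule norm_suminf_le)
    show "norm (a (k + m)) \<le> real n * q ^ Suc m * q ^ k" for k
      using bound[of "k + m"] by (simp add: power_add mult_ac)
    show "summable (\<lambda>k. real n * q ^ Suc m * q ^ k)" using geo by (rule sums_summable)
  qed
  also have "\<dots> = real n * q ^ Suc m / (1 - q)" using sums_unique[OF geo] by simp
  finally show ?thesis by (simp add: q_def)
qed

section \<open>Polynomial functions of bounded degree\<close>

text \<open>
  Functions spanned by monomials in the variables \<open>V\<close> of degree at most \<open>d\<close>.  Working with
  functions instead of formal polynomials leaves addition as the only operation on formal
  polynomials whose evaluation is needed.
\<close>
inductive poly_fun :: "'x set \<Rightarrow> nat \<Rightarrow> (('x \<Rightarrow> complex) \<Rightarrow> complex) \<Rightarrow> bool" for V d where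
  monomial: "Poly_Mapping.keys m \<subseteq> V \<Longrightarrow> (\<Sum>x\<in>Poly_Mapping.keys m. Poly_Mapping.lookup m x) \<le> d
    \<Longrightarrow> poly_fun V d (\<lambda>a. c * (\<Prod>x\<in>Poly_Mapping.keys m. a x ^ Poly_Mapping.lookup m x))"
| add: "poly_fun V d F \<Longrightarrow> poly_fun V d G \<Longrightarrow> poly_fun V d (\<lambda>a. F a + G a)"

lemma poly_fun_mono: "poly_fun V d F \<Longrightarrow> d \<le> e \<Longrightarrow> poly_fun V e F"
  by (induction rule: poly_fun.induct) (auto intro: poly_fun.intros)

lemma poly_fun_const: "poly_fun V d (\<lambda>a. c)"
  using poly_fun.monomial[of 0 V d c] by simp

lemma poly_fun_var: "x \<in> V \<Longrightarrow> poly_fun V (Suc 0) (\<lambda>a. a x)"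
  using poly_fun.monomial[of "Poly_Mapping.single x 1" V "Suc 0" 1] by simp

lemma poly_fun_mult:
  assumes "poly_fun V d F" "poly_fun V e G"
  shows "poly_fun V (d + e) (\<lambda>a. F a * G a)"
  using assms(1)
proof (induction rule: poly_fun.induct)
  case (monomial m c)
  note m = monomial.hyps
  show ?case using assms(2)
  proof (induction rule: poly_fun.induct)
    case (monomial m' c')
    define S where "S = Poly_Mapping.keys m \<union> Poly_Mapping.keys m'"
    have sub: "Poly_Mapping.keys m \<subseteq> S" "Poly_Mapping.keys m' \<subseteq> S"
        "Poly_Mapping.keys (m + m') \<subseteq> S" "finite S"
      by (auto simp: S_def dest: subsetD[OF Poly_Mapping.keys_add])
    have prod: "(\<Prod>x\<in>Poly_Mapping.keys k. a x ^ Poly_Mapping.lookup k x)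
        = (\<Prod>x\<in>S. a x ^ Poly_Mapping.lookup k x)"
      if "Poly_Mapping.keys k \<subseteq> S" for k and a :: "'a \<Rightarrow> complex"
      by (rule prod.mono_neutral_left) (use sub(4) that in \<open>auto simp: in_keys_iff\<close>)
    have deg: "(\<Sum>x\<in>Poly_Mapping.keys k. Poly_Mapping.lookup k x) = (\<Sum>x\<in>S. Poly_Mapping.lookup k x)"
      if "Poly_Mapping.keys k \<subseteq> S" for k :: "'a \<Rightarrow>\<^sub>0 nat"
      by (rule sum.mono_neutral_left) (use sub(4) that in \<open>auto simp: in_keys_iff\<close>)
    have "poly_fun V (d + e) (\<lambda>a. c * c'
        * (\<Prod>x\<in>Poly_Mapping.keys (m + m'). a x ^ Poly_Mapping.lookup (m + m') x))"
    proof (rule poly_fun.monomial)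
      show "Poly_Mapping.keys (m + m') \<subseteq> V" using sub(3) m(1) monomial(1) by (auto simp: S_def)
      have "(\<Sum>x\<in>Poly_Mapping.keys (m + m'). Poly_Mapping.lookup (m + m') x)
          = (\<Sum>x\<in>Poly_Mapping.keys m. Poly_Mapping.lookup m x)
            + (\<Sum>x\<in>Poly_Mapping.keys m'. Poly_Mapping.lookup m' x)"
        unfolding deg[OF sub(1)] deg[OF sub(2)] deg[OF sub(3)]
        by (simp add: lookup_add sum.distrib)
      then show "(\<Sum>x\<in>Poly_Mapping.keys (m + m'). Poly_Mapping.lookup (m + m') x) \<le> d + e"
        using m(2) monomial(2) by simp
    qed
    moreover have "c * c' * (\<Prod>x\<in>Poly_Mapping.keys (m + m'). a x ^ Poly_Mapping.lookup (m + m') x)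
        = c * (\<Prod>x\<in>Poly_Mapping.keys m. a x ^ Poly_Mapping.lookup m x)
          * (c' * (\<Prod>x\<in>Poly_Mapping.keys m'. a x ^ Poly_Mapping.lookup m' x))" for a
      unfolding prod[OF sub(1)] prod[OF sub(2)] prod[OF sub(3)]
      by (simp add: lookup_add power_add prod.distrib)
    ultimately show ?case by simp
  next
    case (add G G')
    then show ?case by (simp add: distrib_left poly_fun.add)
  qed
next
  case (add F F')
  then show ?case by (simp add: distrib_right poly_fun.add)
qed

lemma poly_fun_diff: "poly_fun V d F \<Longrightarrow> poly_fun V d G \<Longrightarrow> poly_fun V d (\<lambda>a. F a - G a)"
  using poly_fun.add[of V d F "\<lambda>a. - 1 * G a"] poly_fun_mult[OF poly_fun_const[of V 0 "- 1"], of d G]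
  by simp

lemma poly_fun_sum: "(\<And>i. i \<in> I \<Longrightarrow> poly_fun V d (F i)) \<Longrightarrow> poly_fun V d (\<lambda>a. \<Sum>i\<in>I. F i a)"
  by (induction I rule: infinite_finite_induct) (simp_all add: poly_fun_const poly_fun.add)

lemma poly_fun_prod:
  assumes "finite I" "\<And>i. i \<in> I \<Longrightarrow> poly_fun V (Suc 0) (F i)"
  shows "poly_fun V (card I) (\<lambda>a. \<Prod>i\<in>I. F i a)"
  using assms
proof (induction I rule: finite_induct)
  case empty
  show ?case by (simp add: poly_fun_const)
next
  case (insert i I)
  then have "poly_fun V (Suc 0 + card I) (\<lambda>a. F i a * (\<Prod>i\<in>I. F i a))"
    by (intro poly_fun_mult) auto
  with insert.hyps show ?case by simp
qed

lemma mpoly_eval_superset: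
  assumes "finite S" "Poly_Mapping.keys p \<subseteq> S"
  shows "mpoly_eval a p = (\<Sum>m\<in>S. Poly_Mapping.lookup p m
    * (\<Prod>x\<in>Poly_Mapping.keys m. a x ^ Poly_Mapping.lookup m x))"
  unfolding mpoly_eval_def
  by (rule sum.mono_neutral_left) (use assms in \<open>auto simp: in_keys_iff\<close>)

lemma mpoly_eval_add: "mpoly_eval a (p + q) = mpoly_eval a p + mpoly_eval a q"
proof -
  have "finite (Poly_Mapping.keys p \<union> Poly_Mapping.keys q)"
    "Poly_Mapping.keys (p + q) \<subseteq> Poly_Mapping.keys p \<union> Poly_Mapping.keys q"
    using Poly_Mapping.keys_add[of p q] by auto
  then show ?thesis
    by (simp add: mpoly_eval_superset[of "Poly_Mapping.keys p \<union> Poly_Mapping.keys q"] lookup_add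
        distrib_right sum.distrib)
qed

lemma mpoly_degree_le_iff:
  "mpoly_degree p \<le> d
     \<longleftrightarrow> (\<forall>m\<in>Poly_Mapping.keys p. (\<Sum>x\<in>Poly_Mapping.keys m. Poly_Mapping.lookup m x) \<le> d)"
  unfolding mpoly_degree_def by (subst Max_le_iff) auto

lemma poly_fun_imp_mpoly:
  assumes "poly_fun V d F"
  shows "\<exists>p. mpoly_vars p \<subseteq> V \<and> mpoly_degree p \<le> d \<and> (\<forall>a. F a = mpoly_eval a p)"
  using assms
proof (induction rule: poly_fun.induct)
  case (monomial m c)
  have keys: "Poly_Mapping.keys (Poly_Mapping.single m c) \<subseteq> {m}" by simp
  have "mpoly_vars (Poly_Mapping.single m c) \<subseteq> V"
    using keys monomial(1) unfolding mpoly_vars_def by blast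
  moreover have "mpoly_degree (Poly_Mapping.single m c) \<le> d"
    using keys monomial(2) unfolding mpoly_degree_le_iff by blast
  moreover have "mpoly_eval a (Poly_Mapping.single m c)
      = c * (\<Prod>x\<in>Poly_Mapping.keys m. a x ^ Poly_Mapping.lookup m x)" for a
    by (subst mpoly_eval_superset[OF _ keys]) auto
  ultimately show ?case by metis
next
  case (add F G)
  then obtain p q where p: "mpoly_vars p \<subseteq> V" "mpoly_degree p \<le> d" "\<And>a. F a = mpoly_eval a p"
    and q: "mpoly_vars q \<subseteq> V" "mpoly_degree q \<le> d" "\<And>a. G a = mpoly_eval a q"
    by blast
  have keys: "Poly_Mapping.keys (p + q) \<subseteq> Poly_Mapping.keys p \<union> Poly_Mapping.keys q"
    by (rule Poly_Mapping.keys_add)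
  have "mpoly_vars (p + q) \<subseteq> V"
    using p(1) q(1) keys unfolding mpoly_vars_def by blast
  moreover have "mpoly_degree (p + q) \<le> d"
    using p(2) q(2) keys unfolding mpoly_degree_le_iff by blast
  moreover have "F a + G a = mpoly_eval a (p + q)" for a by (simp add: mpoly_eval_add p(3) q(3))
  ultimately show ?case by blast
qed

section \<open>Polynomial approximation of the logarithm of the permanent\<close>

lemma poly_fun_coeff_line_poly:
  "poly_fun ({1..n} \<times> {1..n}) k (\<lambda>a. coeff (line_poly n (\<lambda>i j. a (i, j))) k)"
  unfolding coeff_line_poly
proof (rule poly_fun_sum)
  fix M assume M: "M \<in> matchings {1..n} {1..n}"
  show "poly_fun ({1..n} \<times> {1..n}) k (\<lambda>a. if card M = k
      then fact (n - card M) * (\<Prod>e\<in>M. a (fst e, snd e) - 1) else 0)"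
  proof (cases "card M = k")
    case True
    have "poly_fun ({1..n} \<times> {1..n}) (card M) (\<lambda>a. \<Prod>e\<in>M. a (fst e, snd e) - 1)"
    proof (rule poly_fun_prod)
      show "finite M" using finite_matching[OF M] by simp
      fix e assume "e \<in> M"
      then have "(fst e, snd e) \<in> {1..n} \<times> {1..n}" using M by (auto simp: matchings_def)
      then show "poly_fun ({1..n} \<times> {1..n}) (Suc 0) (\<lambda>a. a (fst e, snd e) - 1)"
        by (intro poly_fun_diff poly_fun_var poly_fun_const)
    qed
    from poly_fun_mult[OF poly_fun_const[of _ 0 "fact (n - card M)"] this] True
    show ?thesis by simp
  next
    case False
    then show ?thesis by (simp add: poly_fun_const)
  qed
qed

lemma poly_fun_log_deriv_coeff:
  "poly_fun ({1..n} \<times> {1..n}) (Suc k) (\<lambda>a. log_deriv_coeff n (\<lambda>i j. a (i, j)) k)"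
proof (induction k rule: less_induct)
  case (less k)
  let ?V = "{1..n} \<times> {1..n}"
  have "poly_fun ?V (0 + Suc k) (\<lambda>a. of_nat (Suc k) * coeff (line_poly n (\<lambda>i j. a (i, j))) (Suc k))"
    by (intro poly_fun_mult poly_fun_const poly_fun_coeff_line_poly)
  moreover have "poly_fun ?V (0 + Suc k) (\<lambda>a. \<Sum>i<k.
      log_deriv_coeff n (\<lambda>i j. a (i, j)) i * coeff (line_poly n (\<lambda>i j. a (i, j))) (k - i))"
  proof (rule poly_fun_sum)
    fix i assume "i \<in> {..<k}"
    then have i: "i < k" by simp
    then have "0 + Suc k = Suc i + (k - i)" by simp
    then show "poly_fun ?V (0 + Suc k) (\<lambda>a.
        log_deriv_coeff n (\<lambda>i j. a (i, j)) i * coeff (line_poly n (\<lambda>i j. a (i, j))) (k - i))"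
      using poly_fun_mult[OF less[OF i] poly_fun_coeff_line_poly[of n "k - i"]] by (simp only:)
  qed
  ultimately have "poly_fun ?V (0 + Suc k) (\<lambda>a.
      of_nat (Suc k) * coeff (line_poly n (\<lambda>i j. a (i, j))) (Suc k) - (\<Sum>i<k.
      log_deriv_coeff n (\<lambda>i j. a (i, j)) i * coeff (line_poly n (\<lambda>i j. a (i, j))) (k - i)))"
    by (rule poly_fun_diff)
  from poly_fun_mult[OF poly_fun_const[of _ 0 "1 / fact n"] this] show ?case
    by (subst log_deriv_coeff_rec) (simp only: add_0 times_divide_eq_left mult_1)
qed

lemma ln_per_partial_mpoly:
  "\<exists>p :: (nat \<times> nat, complex) mpoly. mpoly_vars p \<subseteq> {1..n} \<times> {1..n} \<and> mpoly_degree p \<le> m \<and>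
     (\<forall>A. ln_per_partial n m A = mpoly_eval (\<lambda>(i, j). A i j) p)"
proof -
  let ?V = "{1..n} \<times> {1..n}"
  have "poly_fun ?V m (\<lambda>a. of_real (ln (fact n))
      + (\<Sum>k<m. log_deriv_coeff n (\<lambda>i j. a (i, j)) k * (1 / of_nat (Suc k))))"
  proof (intro poly_fun.add poly_fun_const poly_fun_sum)
    fix k assume "k \<in> {..<m}"
    then have "Suc k + 0 \<le> m" by simp
    with poly_fun_mult[OF poly_fun_log_deriv_coeff poly_fun_const]
    show "poly_fun ?V m (\<lambda>a. log_deriv_coeff n (\<lambda>i j. a (i, j)) k * (1 / of_nat (Suc k)))"
      by (rule poly_fun_mono)
  qed
  from poly_fun_imp_mpoly[OF this] obtain p :: "(nat \<times> nat, complex) mpoly"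
    where p: "mpoly_vars p \<subseteq> ?V" "mpoly_degree p \<le> m"
    and eval: "\<And>a. of_real (ln (fact n))
      + (\<Sum>k<m. log_deriv_coeff n (\<lambda>i j. a (i, j)) k * (1 / of_nat (Suc k))) = mpoly_eval a p"
    by blast
  have "ln_per_partial n m A = mpoly_eval (\<lambda>(i, j). A i j) p" for A
    using eval[of "\<lambda>(i, j). A i j"] by (simp add: ln_per_partial_def del: of_nat_Suc)
  with p show ?thesis by blast
qed

text \<open>
  The degree needed to push the geometric error below \<open>\<epsilon>\<close>.  A lower bound on \<open>x\<close>, which stands for
  \<open>ln n - ln \<epsilon>\<close>, absorbs the additive constants into the factor \<open>\<gamma>\<close>.
\<close>
lemma geometric_degree_bound:
  fixes q :: real
  assumes "0 \<le> q" "q < 1"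
  obtains \<gamma> where "\<gamma> > 0"
    "\<And>x. x \<ge> ln 2 \<Longrightarrow> \<exists>m. real m \<le> \<gamma> * x \<and> q ^ Suc m / (1 - q) \<le> exp (- x)"
proof -
  (* Raising the ratio to at least 1/2 keeps the logarithm finite when q = 0. *)
  define p where "p = max q (1 / 2)"
  have p: "q \<le> p" "0 < p" "p < 1" using assms by (auto simp: p_def)
  define \<mu> where "\<mu> = - ln p"
  define K where "K = - ln (1 - p)"
  have \<mu>: "\<mu> > 0" using p by (simp add: \<mu>_def)
  have K: "K > 0" using p by (simp add: K_def)
  define \<gamma> where "\<gamma> = 1 / \<mu> + (K / \<mu> + 1) / ln 2"
  show thesis
  proof (rule that[of \<gamma>])
    have ln2: "ln (2::real) > 0" by simp
    show "\<gamma> > 0" unfolding \<gamma>_def using \<mu> K ln2 by (intro add_pos_pos divide_pos_pos) auto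
    fix x :: real assume x: "x \<ge> ln 2"
    define m where "m = nat \<lceil>(x + K) / \<mu>\<rceil>"
    have pos: "(x + K) / \<mu> \<ge> 0" using x K \<mu> ln2 by (intro divide_nonneg_pos) linarith+
    have m: "(x + K) / \<mu> \<le> real m" "real m \<le> (x + K) / \<mu> + 1"
      using pos unfolding m_def by linarith+
    have "1 \<le> x / ln 2" using x ln2 by simp
    then have "(K / \<mu> + 1) * 1 \<le> (K / \<mu> + 1) * (x / ln 2)"
      using K \<mu> by (intro mult_left_mono) auto
    moreover have "\<gamma> * x = x / \<mu> + (K / \<mu> + 1) * (x / ln 2)"
      by (simp add: \<gamma>_def distrib_right)
    ultimately have deg: "real m \<le> \<gamma> * x" using m(2) by (simp add: add_divide_distrib)
    have "p ^ m / (1 - p) = exp (- (real m * \<mu>) + K)"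
    proof -
      have "exp (real m * ln p) = p ^ m" "exp (ln (1 - p)) = 1 - p"
        using p by (simp_all add: exp_of_nat_mult)
      then show ?thesis using exp_diff[of "real m * ln p" "ln (1 - p)"] by (simp add: \<mu>_def K_def)
    qed
    also have "\<dots> \<le> exp (- x)"
      using m(1) \<mu> by (simp add: field_simps)
    finally have "p ^ m / (1 - p) \<le> exp (- x)" .
    moreover have "q ^ Suc m / (1 - q) \<le> p ^ m / (1 - p)"
    proof (rule frac_le)
      have "q ^ Suc m \<le> q ^ m" using assms by (simp add: mult_left_le_one_le)
      also have "\<dots> \<le> p ^ m" using assms p by (intro power_mono) auto
      finally show "q ^ Suc m \<le> p ^ m" .
    qed (use p in auto)
    ultimately show "\<exists>m. real m \<le> \<gamma> * x \<and> q ^ Suc m / (1 - q) \<le> exp (- x)"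
      using deg by (meson order_trans)
  qed
qed

theorem theorem1p7:
  fixes \<eta> :: real
  assumes "0 \<le> \<eta>" and "\<eta> < alpha / 4"
  shows "\<exists>\<gamma>::real. \<gamma> > 0 \<and>
    (\<forall>(n::nat) (\<epsilon>::real). n \<ge> 1 \<and> 0 < \<epsilon> \<and> \<epsilon> < 1 \<longrightarrow>
      (\<exists>p :: (nat \<times> nat, complex) mpoly.
         mpoly_vars p \<subseteq> {1..n} \<times> {1..n} \<and>
         real (mpoly_degree p) \<le> \<gamma> * (ln (real n) - ln \<epsilon>) \<and>
         (\<forall>A :: nat \<Rightarrow> nat \<Rightarrow> complex.
            (\<forall>i\<in>{1..n}. (\<Sum>j = 1..n. cmod (1 - A i j)) \<le> \<eta> * real n) \<and>
            (\<forall>j\<in>{1..n}. (\<Sum>i = 1..n. cmod (1 - A i j)) \<le> \<eta> * real n) \<longrightarrow>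
            cmod (ln_per n A - mpoly_eval (\<lambda>(i, j). A i j) p) \<le> \<epsilon>)))"
proof -
  define q where "q = \<eta> / (alpha / 4)"
  have q: "0 \<le> q" "q < 1" using assms alpha_pos by (auto simp: q_def)
  obtain \<gamma> where \<gamma>: "\<gamma> > 0"
    "\<And>x. x \<ge> ln 2 \<Longrightarrow> \<exists>m. real m \<le> \<gamma> * x \<and> q ^ Suc m / (1 - q) \<le> exp (- x)"
    using geometric_degree_bound[OF q] by blast
  have approx: "\<exists>m. real m \<le> \<gamma> * (ln (real n) - ln \<epsilon>) \<and>
      (\<forall>A\<in>near_ones n \<eta>. norm (ln_per n A - ln_per_partial n m A) \<le> \<epsilon>)"
    if n: "n \<ge> 1" and \<epsilon>: "0 < \<epsilon>" "\<epsilon> < 1" for n \<epsilon>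
  proof (cases "ln (real n) - ln \<epsilon> \<ge> ln 2")
    case True
    then obtain m where m: "real m \<le> \<gamma> * (ln (real n) - ln \<epsilon>)"
      "q ^ Suc m / (1 - q) \<le> exp (- (ln (real n) - ln \<epsilon>))"
      using \<gamma>(2) by blast
    have "norm (ln_per n A - ln_per_partial n m A) \<le> \<epsilon>" if A: "A \<in> near_ones n \<eta>" for A
    proof -
      have "norm (ln_per n A - ln_per_partial n m A) \<le> real n * q ^ Suc m / (1 - q)"
        unfolding q_def
        by (rule ln_per_partial_error[OF n permanent_nonzero_alpha[OF n] assms(1,2) _ A])
          (use assms(2) in simp_all)
      also have "\<dots> = real n * (q ^ Suc m / (1 - q))" by simp
      also have "\<dots> \<le> real n * exp (- (ln (real n) - ln \<epsilon>))"
        using m(2) by (intro mult_left_mono) auto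
      also have "\<dots> = \<epsilon>" using n \<epsilon> by (simp add: exp_diff)
      finally show ?thesis .
    qed
    with m(1) show ?thesis by blast
  next
    case False
    (* Only n = 1 and epsilon > 1 / 2 remain; the degree bound may then force a constant. *)
    have "ln \<epsilon> < 0" using \<epsilon> by simp
    with False have "ln (real n) < ln 2" by linarith
    then have "n = 1" using n by simp
    with False have "ln \<epsilon> > ln (1 / 2)" by (simp add: ln_div)
    then have "\<epsilon> > 1 / 2" using \<epsilon> by simp
    have \<eta>: "\<eta> \<le> 1 / 8" using assms(2) alpha_le_half by simp
    have "norm (ln_per n A - ln_per_partial n 0 A) \<le> \<epsilon>" if A: "A \<in> near_ones n \<eta>" for A
    proof -
      have "norm (ln_per n A - ln_per_partial n 0 A)
          \<le> real n * (\<eta> / (1 / 2)) ^ Suc 0 / (1 - \<eta> / (1 / 2))"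
      proof (rule ln_per_partial_error[OF n _ assms(1) _ _ A])
        show "permanent n Z \<noteq> 0" if "Z \<in> near_ones n (1 / 2)" for Z
          using permanent_one_nonzero that \<open>n = 1\<close> by blast
      qed (use \<eta> assms(2) in simp_all)
      also have "\<dots> \<le> 1 / 2" using \<eta> \<open>n = 1\<close> by (simp add: field_simps)
      finally show ?thesis using \<open>\<epsilon> > 1 / 2\<close> by simp
    qed
    moreover have "real 0 \<le> \<gamma> * (ln (real n) - ln \<epsilon>)"
      using \<gamma>(1) \<open>n = 1\<close> \<open>ln \<epsilon> < 0\<close> by (simp add: mult_nonneg_nonpos)
    ultimately show ?thesis by blast
  qed
  show ?thesis
  proof (intro exI[of _ \<gamma>] conjI \<gamma>(1) allI impI)
    fix n :: nat and \<epsilon> :: real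
    assume asm: "n \<ge> 1 \<and> 0 < \<epsilon> \<and> \<epsilon> < 1"
    then obtain m where m: "real m \<le> \<gamma> * (ln (real n) - ln \<epsilon>)"
      "\<And>A. A \<in> near_ones n \<eta> \<Longrightarrow> norm (ln_per n A - ln_per_partial n m A) \<le> \<epsilon>"
      using approx by blast
    obtain p :: "(nat \<times> nat, complex) mpoly"
      where p: "mpoly_vars p \<subseteq> {1..n} \<times> {1..n}" "mpoly_degree p \<le> m"
        "\<And>A. ln_per_partial n m A = mpoly_eval (\<lambda>(i, j). A i j) p"
      using ln_per_partial_mpoly by blast
    have "real (mpoly_degree p) \<le> \<gamma> * (ln (real n) - ln \<epsilon>)" using p(2) m(1) by simp
    moreover have "cmod (ln_per n A - mpoly_eval (\<lambda>(i, j). A i j) p) \<le> \<epsilon>"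
      if "A \<in> near_ones n \<eta>" for A
      using m(2)[OF that] by (simp only: p(3))
    ultimately show "\<exists>p :: (nat \<times> nat, complex) mpoly.
         mpoly_vars p \<subseteq> {1..n} \<times> {1..n} \<and>
         real (mpoly_degree p) \<le> \<gamma> * (ln (real n) - ln \<epsilon>) \<and>
         (\<forall>A :: nat \<Rightarrow> nat \<Rightarrow> complex.
            (\<forall>i\<in>{1..n}. (\<Sum>j = 1..n. cmod (1 - A i j)) \<le> \<eta> * real n) \<and>
            (\<forall>j\<in>{1..n}. (\<Sum>i = 1..n. cmod (1 - A i j)) \<le> \<eta> * real n) \<longrightarrow>
            cmod (ln_per n A - mpoly_eval (\<lambda>(i, j). A i j) p) \<le> \<epsilon>)"
      using p(1) unfolding near_ones_def mem_Collect_eq by blast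
  qed
qed

end
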